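(* There are absolute constants $c_1,c_2>0$ and a deterministic distributed algorithm in the CONGEST model such that for every integer parameter $\kappa\ge 2$ and every $n$-vertex ($n\ge 2$) connected unweighted undirected graph $G=(V,E)$, the algorithm constructs a $\left((4\log n+1)^{\kappa-1}+1\right)$-spanner $H$ of $G$ with at most $n^{1+\frac1\kappa}$ edges, in $O(\log n)^{\kappa-1}$ rounds, i.e., in at most $c_1\,(c_2\log n)^{\kappa-1}$ rounds.
   Context: All logarithms are to base $2$. A subgraph $G'=(V,H)$ of $G=(V,E)$ is an $\alpha$-spanner of $G$ ($\alpha\ge 1$) if $d_{G'}(u,v)\le \alpha\cdot d_G(u,v)$ for all $u,v\in V$, where $d_G,d_{G'}$ are the hop-distances in $G$ and $G'$. CONGEST model: each vertex of the input graph $G$ hosts a processor; vertices have distinct IDs in $\{1,2,\dots,O(n)\}$. Computation proceeds in synchronous rounds; in each round every vertex may send to each of its neighbors in $G$ a message containing $O(1)$ vertex IDs (i.e. $O(\log n)$ bits). Every vertex knows $n$ and $\kappa$. The running time is the number of rounds of communication. Constructing a spanner means that at termination every vertex knows which of its incident edges belong to the spanner. *)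

theory Defs
  imports Complex_Main "HOL-Library.Extended_Real"
begin

section \<open>Unweighted undirected graphs\<close>

definition simple_graph :: "'v set \<Rightarrow> 'v set set \<Rightarrow> bool" where
  "simple_graph V E \<longleftrightarrow> finite V \<and> (\<forall>e\<in>E. e \<subseteq> V \<and> card e = 2)"

definition adj :: "'v set set \<Rightarrow> ('v \<times> 'v) set" where
  "adj E = {(u, v). {u, v} \<in> E}"

definition connected_graph :: "'v set \<Rightarrow> 'v set set \<Rightarrow> bool" where
  "connected_graph V E \<longleftrightarrow> (\<forall>u\<in>V. \<forall>v\<in>V. (u, v) \<in> (adj E)\<^sup>*)"

text \<open>The distance is \<open>\<infinity>\<close> when there is no walk: the infimum of the empty set in
  \<^typ>\<open>enat\<close> is \<open>\<infinity>\<close>.\<close>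

definition hop_dist :: "'v set set \<Rightarrow> 'v \<Rightarrow> 'v \<Rightarrow> enat" where
  "hop_dist E u v = (INF k \<in> {k. (u, v) \<in> adj E ^^ k}. enat k)"

definition spanner :: "real \<Rightarrow> 'v set \<Rightarrow> 'v set set \<Rightarrow> 'v set set \<Rightarrow> bool" where
  "spanner \<alpha> V E H \<longleftrightarrow> H \<subseteq> E \<and>
     (\<forall>u\<in>V. \<forall>v\<in>V. ereal_of_enat (hop_dist H u v) \<le> ereal \<alpha> * ereal_of_enat (hop_dist E u v))"


section \<open>The CONGEST model\<close>

text \<open>
  A vertex is represented by its ID, a positive natural number; a message is a list of numbers
  from the ID range. The list of what a vertex received in rounds \<open>1, 2, \<dots>\<close> determines the state
  of its (deterministic) processor, so an algorithm is given by functions of that list, called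
  the transcript. Each entry maps the ID of a neighbour to the message that neighbour sent in
  that round, and is \<^const>\<open>None\<close> at IDs from which nothing was received.
  Apart from its transcript a vertex knows \<open>n\<close>, \<open>\<kappa>\<close> and its own ID, in this argument
  order below; in particular it is not told initially who its neighbours are. Local computation
  is unrestricted.
\<close>

type_synonym message = "nat list"
type_synonym transcript = "(nat \<rightharpoonup> message) list"

text \<open>
  \<open>send A n \<kappa> v h w\<close> is the message that \<open>v\<close> puts on the link to \<open>w\<close> (delivered only if \<open>w\<close> is
  a neighbour of \<open>v\<close>). \<open>decide A n \<kappa> v h\<close> is \<^const>\<open>None\<close> as long as \<open>v\<close> keeps running, and
  \<open>Some N\<close> when \<open>v\<close> halts with output \<open>N\<close>, the set of those neighbours \<open>w\<close> for which \<open>v\<close>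
  declares the edge \<open>{v, w}\<close> to be selected.
\<close>

record algorithm =
  send :: "nat \<Rightarrow> nat \<Rightarrow> nat \<Rightarrow> transcript \<Rightarrow> nat \<Rightarrow> message option"
  decide :: "nat \<Rightarrow> nat \<Rightarrow> nat \<Rightarrow> transcript \<Rightarrow> nat set option"

text \<open>
  With IDs from \<open>{1..C * n}\<close>, every message consists of at most \<open>B\<close> IDs, where \<open>B\<close> depends
  neither on \<open>n\<close> nor on \<open>\<kappa>\<close>.
\<close>

definition congest_algorithm :: "nat \<Rightarrow> nat \<Rightarrow> algorithm \<Rightarrow> bool" where
  "congest_algorithm C B A \<longleftrightarrow>
     (\<forall>n \<kappa> v h w m. send A n \<kappa> v h w = Some m \<longrightarrow> length m \<le> B \<and> set m \<subseteq> {1..C * n})"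

text \<open>
  Transcripts after a number of synchronous rounds on the graph with edge set \<open>E\<close>. A vertex that
  has halted sends nothing any more, and its transcript is frozen, so its output is final.
\<close>

primrec run :: "algorithm \<Rightarrow> nat \<Rightarrow> nat \<Rightarrow> nat set set \<Rightarrow> nat \<Rightarrow> nat \<Rightarrow> transcript" where
  "run A n \<kappa> E 0 = (\<lambda>v. [])"
| "run A n \<kappa> E (Suc r) = (\<lambda>v.
     if decide A n \<kappa> v (run A n \<kappa> E r v) \<noteq> None then run A n \<kappa> E r v
     else run A n \<kappa> E r v @
       [\<lambda>u. if {u, v} \<in> E \<and> decide A n \<kappa> u (run A n \<kappa> E r u) = None
            then send A n \<kappa> u (run A n \<kappa> E r u) v else None])"

text \<open>
  Within \<open>T\<close> rounds every vertex has halted, and it knows exactly which of its incident edges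
  belong to \<open>H\<close>.
\<close>

definition constructs ::
  "algorithm \<Rightarrow> nat \<Rightarrow> nat \<Rightarrow> nat set \<Rightarrow> nat set set \<Rightarrow> nat \<Rightarrow> nat set set \<Rightarrow> bool" where
  "constructs A n \<kappa> V E T H \<longleftrightarrow>
     (\<forall>v\<in>V. decide A n \<kappa> v (run A n \<kappa> E T v) = Some {w. {v, w} \<in> H})"

end

theory Submission
  imports Defs
begin

text \<open>
  Clusters are grown in \<open>\<kappa> - 1\<close> phases. Put \<open>\<theta> = n powr (1 / \<kappa>)\<close>. In each phase a live vertex that
  sees at most \<open>\<theta>\<close> live clusters, its own included, selects one edge to each of the others and dies,
  which costs at most \<open>\<theta> - 1\<close> edges. The clusters containing a surviving vertex are merged around a
  ruling set: its members are pairwise at distance at least 3 in the cluster graph, so each has more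
  than \<open>\<theta>\<close> live clusters to itself, and the number of live clusters drops by the factor \<open>\<theta>\<close>. After
  \<open>\<kappa> - 1\<close> phases at most \<open>\<theta>\<close> live clusters remain and every live vertex dies. Only then is a spanning
  tree of each final cluster built, one parent edge per vertex; as clusters are never split, these
  trees also serve the edges selected in earlier phases, and the total is at most \<open>n * \<theta>\<close> edges.

  The ruling set is computed by running through the \<open>m = \<lfloor>log 2 n\<rfloor>\<close> digits of the cluster IDs in base
  \<open>4 * C\<close>: for each digit position, the candidates with digit \<open>0, 1, \<dots>\<close> in turn flood a single bit to
  distance 2 and eliminate the candidates there with a larger digit. Since all floods of a step carry
  the same bit there is no congestion, and every candidate ends up within distance \<open>2 * m\<close> of a
  survivor. The large base makes \<open>m\<close> digits suffice although the IDs go up to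
  \<open>C * n\<close>. A phase thus turns radius \<open>r\<close> into \<open>r + 2 * m * (2 * r + 1)\<close>, that is, multiplies
  \<open>2 * r + 1\<close> by \<open>4 * m + 1\<close>, in \<open>O(C * m * (2 * r + 1))\<close> rounds.
\<close>

section \<open>Round programs\<close>

text \<open>
  A program is a list of operations, one per round, in each of which every vertex sends its fields
  \<open>cl\<close> (its cluster) and \<open>val\<close> (a working register, empty if 0) to all neighbours. One extra round at the end
  informs the other endpoints of the selected edges.
\<close>

record vstate =
  vid :: nat
  cl :: nat
  val :: nat
  live :: bool
  cand :: bool
  sel :: "nat set"

type_synonym inbox = "nat \<rightharpoonup> nat \<times> nat"
type_synonym op = "vstate \<Rightarrow> inbox \<Rightarrow> vstate"

definition inb :: "nat set set \<Rightarrow> (nat \<Rightarrow> vstate) \<Rightarrow> nat \<Rightarrow> inbox" where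
  "inb E \<sigma> v = (\<lambda>u. if {u, v} \<in> E then Some (cl (\<sigma> u), val (\<sigma> u)) else None)"

definition step :: "nat set set \<Rightarrow> op \<Rightarrow> (nat \<Rightarrow> vstate) \<Rightarrow> nat \<Rightarrow> vstate" where
  "step E f \<sigma> = (\<lambda>v. f (\<sigma> v) (inb E \<sigma> v))"

definition exec :: "nat set set \<Rightarrow> op list \<Rightarrow> (nat \<Rightarrow> vstate) \<Rightarrow> nat \<Rightarrow> vstate" where
  "exec E ops = fold (step E) ops"

lemma exec_Nil [simp]: "exec E [] \<sigma> = \<sigma>"
  and exec_Cons: "exec E (f # fs) \<sigma> = exec E fs (step E f \<sigma>)"
  and exec_append: "exec E (fs @ gs) \<sigma> = exec E gs (exec E fs \<sigma>)"
  by (simp_all add: exec_def)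

definition init :: "nat \<Rightarrow> vstate" where
  "init v = \<lparr>vid = v, cl = v, val = 1, live = True, cand = False, sel = {}\<rparr>"

text \<open>Zero is allowed in the second component, where it means an empty register:
  \<open>encode\<close> omits it, so every number sent is a genuine ID.\<close>

definition valid_pair :: "nat \<Rightarrow> nat \<times> nat \<Rightarrow> bool" where
  "valid_pair N p \<longleftrightarrow> fst p \<in> {1..N} \<and> snd p \<le> N"

definition valid_op :: "nat \<Rightarrow> op \<Rightarrow> bool" where
  "valid_op N f \<longleftrightarrow> (\<forall>st ib. valid_pair N (cl st, val st) \<longrightarrow> (\<forall>p\<in>ran ib. valid_pair N p) \<longrightarrow>
     valid_pair N (cl (f st ib), val (f st ib)))"

lemma valid_exec:
  assumes "simple_graph V E" "\<forall>f\<in>set fs. valid_op N f"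
    and "\<forall>v\<in>V. valid_pair N (cl (\<sigma> v), val (\<sigma> v))" "v \<in> V"
  shows "valid_pair N (cl (exec E fs \<sigma> v), val (exec E fs \<sigma> v))"
  using assms(2-4)
proof (induction fs arbitrary: \<sigma> v)
  case (Cons f fs)
  have "valid_pair N (cl (step E f \<sigma> v), val (step E f \<sigma> v))" if "v \<in> V" for v
  proof -
    have "\<forall>p\<in>ran (inb E \<sigma> v). valid_pair N p"
      using Cons.prems(2) assms(1)
      by (auto simp: inb_def ran_def simple_graph_def split: if_splits)
    then show ?thesis
      using Cons.prems(1,2) that unfolding step_def valid_op_def by simp
  qed
  then show ?case
    using Cons by (simp add: exec_Cons)
qed simp

section \<open>From round programs to CONGEST algorithms\<close>

definition encode :: "nat \<times> nat \<Rightarrow> message" where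
  "encode p = (if snd p = 0 then [fst p] else [fst p, snd p])"

definition decode :: "message \<Rightarrow> nat \<times> nat" where
  "decode m = (hd m, if tl m = [] then 0 else hd (tl m))"

lemma decode_encode [simp]: "decode (encode p) = p"
  by (cases p) (simp add: decode_def encode_def)

lemma valid_pair_encode: "valid_pair N p \<Longrightarrow> set (encode p) \<subseteq> {1..N}"
  by (auto simp: valid_pair_def encode_def)

text \<open>The state is recomputed from the transcript. Since \<open>zip\<close> stops at the end
  of the program, the messages of the extra last round leave it unchanged.\<close>

definition local_state :: "op list \<Rightarrow> nat \<Rightarrow> transcript \<Rightarrow> vstate" where
  "local_state P v h = fold (\<lambda>(f, e) st. f st (map_option decode \<circ> e)) (zip P h) (init v)"

lemma local_state_snoc:
  assumes "length h < length P"
  shows "local_state P v (h @ [e]) = (P ! length h) (local_state P v h) (map_option decode \<circ> e)"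
proof -
  have "zip P (h @ [e]) = zip P h @ zip (drop (length h) P) [e]"
    using zip_append2[of P h "[]"] by (simp add: zip_append2)
  also have "drop (length h) P = P ! length h # drop (Suc (length h)) P"
    using assms by (simp add: Cons_nth_drop_Suc)
  finally have "zip P (h @ [e]) = zip P h @ [(P ! length h, e)]"
    by simp
  then show ?thesis
    by (simp add: local_state_def)
qed

text \<open>The range test in \<open>send\<close> enforces the message format on every transcript,
  even one that no run produces. In the extra round the empty message \<open>[]\<close> announces a
  selected edge, and \<open>dom (last h)\<close> collects the announcers.\<close>

definition algorithm_of :: "nat \<Rightarrow> (nat \<Rightarrow> nat \<Rightarrow> op list) \<Rightarrow> algorithm" where
  "algorithm_of C prog = \<lparr>
     send = (\<lambda>n \<kappa> v h w. let P = prog n \<kappa>; st = local_state P v h; m = encode (cl st, val st) in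
       if length h < length P then (if set m \<subseteq> {1..C * n} then Some m else None)
       else if w \<in> sel st then Some [] else None),
     decide = (\<lambda>n \<kappa> v h. let P = prog n \<kappa> in
       if length h \<le> length P then None
       else Some (sel (local_state P v h) \<union> dom (last h)))\<rparr>"

lemma congest_algorithm_of: "congest_algorithm C 2 (algorithm_of C prog)"
  by (auto simp: congest_algorithm_def algorithm_of_def Let_def encode_def split: if_splits)

text \<open>No vertex halts before the program is over, and the range test never fails at a vertex
  of \<open>V\<close>, so in every round the decoded messages are exactly
  \<open>inb\<close>.\<close>

lemma run_algorithm_of:
  assumes G: "simple_graph V E" "V \<subseteq> {1..C * n}" and ok: "\<forall>f\<in>set (prog n \<kappa>). valid_op (C * n) f"
    and "r \<le> length (prog n \<kappa>)"
  defines "A \<equiv> algorithm_of C prog" and "P \<equiv> prog n \<kappa>"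
  shows "length (run A n \<kappa> E r v) = r \<and>
    local_state P v (run A n \<kappa> E r v) = exec E (take r P) init v"
  using assms(4)
proof (induction r arbitrary: v)
  case 0
  show ?case by (simp add: local_state_def)
next
  case (Suc r)
  define h where "h = run A n \<kappa> E r"
  define \<sigma> where "\<sigma> = exec E (take r P) init"
  have r: "r < length P"
    using Suc.prems P_def by simp
  have h: "length (h v) = r" "local_state P v (h v) = \<sigma> v" for v
    using Suc.IH[of v] Suc.prems by (simp_all add: h_def \<sigma>_def)
  have run: "decide A n \<kappa> v (h v) = None" for v
    using r by (simp add: A_def algorithm_of_def P_def[symmetric] h)
  have msg: "send A n \<kappa> u (h u) w = Some (encode (cl (\<sigma> u), val (\<sigma> u)))" if "u \<in> V" for u w
  proof -
    have "\<forall>v\<in>V. valid_pair (C * n) (cl (init v), val (init v))"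
      using G(2) by (auto simp: valid_pair_def init_def Suc_le_eq intro!: Nat.gr0I)
    moreover have "\<forall>f\<in>set (take r P). valid_op (C * n) f"
      unfolding P_def using ok by (auto dest: in_set_takeD)
    ultimately have "valid_pair (C * n) (cl (\<sigma> u), val (\<sigma> u))"
      unfolding \<sigma>_def using valid_exec[OF G(1)] that by blast
    then show ?thesis
      using r valid_pair_encode[of "C * n"] by (simp add: Let_def A_def algorithm_of_def P_def[symmetric] h)
  qed
  define e where "e = (\<lambda>u. if {u, v} \<in> E then send A n \<kappa> u (h u) v else None)"
  have R: "run A n \<kappa> E (Suc r) v = h v @ [e]"
    using run unfolding e_def h_def by simp
  have "map_option decode \<circ> e = inb E \<sigma> v"
  proof
    fix u
    show "(map_option decode \<circ> e) u = inb E \<sigma> v u"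
    proof (cases "{u, v} \<in> E")
      case True
      then have "u \<in> V"
        using G(1) by (auto simp: simple_graph_def)
      then show ?thesis
        using True by (simp add: e_def inb_def msg)
    qed (simp add: e_def inb_def)
  qed
  then have "local_state P v (run A n \<kappa> E (Suc r) v) = step E (P ! r) \<sigma> v"
    unfolding R using r by (simp add: local_state_snoc h step_def)
  also have "\<dots> = exec E (take (Suc r) P) init v"
    using r by (simp add: take_Suc_conv_app_nth exec_append exec_Cons \<sigma>_def)
  finally show ?case
    unfolding R by (simp add: h)
qed

definition selected_edges :: "(nat \<Rightarrow> vstate) \<Rightarrow> nat set set" where
  "selected_edges \<sigma> = {{v, w} | v w. w \<in> sel (\<sigma> v)}"

text \<open>A vertex knows its own selections, and the extra round tells the other endpoint.
  \<open>selected_edges\<close> ranges over all naturals, hence the separate hypothesis for those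
  outside \<open>V\<close>.\<close>

lemma algorithm_of_constructs:
  assumes G: "simple_graph V E" "V \<subseteq> {1..C * n}" and ok: "\<forall>f\<in>set (prog n \<kappa>). valid_op (C * n) f"
    and sel: "\<And>v. v \<in> V \<Longrightarrow> \<forall>w\<in>sel (exec E (prog n \<kappa>) init v). {v, w} \<in> E"
    and sel': "\<And>v. v \<notin> V \<Longrightarrow> sel (exec E (prog n \<kappa>) init v) = {}"
  shows "constructs (algorithm_of C prog) n \<kappa> V E (Suc (length (prog n \<kappa>)))
    (selected_edges (exec E (prog n \<kappa>) init))"
  unfolding constructs_def
proof
  fix v assume v: "v \<in> V"
  define A where "A = algorithm_of C prog"
  define P where "P = prog n \<kappa>"
  define h where "h = run A n \<kappa> E (length P)"
  define \<sigma> where "\<sigma> = exec E P init"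
  have h: "length (h v) = length P" "local_state P v (h v) = \<sigma> v" for v
    using run_algorithm_of[where C = C and prog = prog and n = n and \<kappa> = \<kappa>, OF G ok order_refl, of v] by (simp_all add: h_def \<sigma>_def A_def P_def)
  have run: "decide A n \<kappa> v (h v) = None" for v
    by (simp add: A_def algorithm_of_def P_def[symmetric] h)
  define e where "e = (\<lambda>u. if {u, v} \<in> E then send A n \<kappa> u (h u) v else None)"
  have R: "run A n \<kappa> E (Suc (length P)) v = h v @ [e]"
    using run unfolding e_def h_def by simp
  have snd: "send A n \<kappa> u (h u) v = (if v \<in> sel (\<sigma> u) then Some [] else None)" for u
    using h by (simp add: A_def algorithm_of_def P_def[symmetric])
  have "local_state P v (h v @ [e]) = local_state P v (h v)"
    using h(1) zip_append2[of P "h v" "[]"] by (simp add: local_state_def zip_append2)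
  then have "decide A n \<kappa> v (run A n \<kappa> E (Suc (length P)) v) = Some (sel (\<sigma> v) \<union> dom e)"
    unfolding R by (simp add: A_def algorithm_of_def P_def[symmetric] h)
  also have "sel (\<sigma> v) \<union> dom e = {w. {v, w} \<in> selected_edges \<sigma>}"
  proof (intro set_eqI iffI)
    fix w assume "w \<in> sel (\<sigma> v) \<union> dom e"
    then show "w \<in> {w. {v, w} \<in> selected_edges \<sigma>}"
      by (auto simp: e_def snd selected_edges_def split: if_splits) (metis insert_commute)
  next
    fix w assume "w \<in> {w. {v, w} \<in> selected_edges \<sigma>}"
    then obtain a b where ab: "b \<in> sel (\<sigma> a)" "{v, w} = {a, b}"
      by (auto simp: selected_edges_def)
    then have "a \<in> V"
      using sel' by (metis P_def \<sigma>_def empty_iff)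
    then have "{a, b} \<in> E"
      using ab sel by (simp add: P_def \<sigma>_def)
    then show "w \<in> sel (\<sigma> v) \<union> dom e"
      using ab by (auto simp: e_def snd doubleton_eq_iff dom_def)
  qed
  finally show "decide (algorithm_of C prog) n \<kappa> v
      (run (algorithm_of C prog) n \<kappa> E (Suc (length (prog n \<kappa>))) v) =
      Some {w. {v, w} \<in> selected_edges (exec E (prog n \<kappa>) init)}"
    by (simp add: A_def P_def \<sigma>_def)
qed


section \<open>Ruling sets by digits\<close>

definition digit :: "nat \<Rightarrow> nat \<Rightarrow> nat \<Rightarrow> nat" where
  "digit b t k = k div b ^ t mod b"

lemma digit_less: "b > 0 \<Longrightarrow> digit b t k < b"
  by (simp add: digit_def)

text \<open>The induction strips the lowest digit: position \<open>t\<close> of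
  \<open>k div b\<close> is position \<open>Suc t\<close> of \<open>k\<close>.\<close>

lemma eq_if_digits_eq:
  assumes "k < b ^ m" "l < b ^ m" "\<And>t. t < m \<Longrightarrow> digit b t k = digit b t l"
  shows "k = l"
  using assms
proof (induction m arbitrary: k l)
  case (Suc m)
  have "k mod b = l mod b"
    using Suc.prems(3)[of 0] by (simp add: digit_def)
  moreover have "k div b = l div b"
  proof (rule Suc.IH)
    show "k div b < b ^ m" "l div b < b ^ m"
      using Suc.prems by (simp_all add: less_mult_imp_div_less mult.commute)
    show "digit b t (k div b) = digit b t (l div b)" if "t < m" for t
      using Suc.prems(3)[of "Suc t"] that by (simp add: digit_def div_mult2_eq)
  qed
  ultimately show ?case
    by (metis div_mult_mod_eq)
qed simp

text \<open>Only digits larger than \<open>j\<close> are removed, so an eliminator, whose digit is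
  \<open>j\<close>, survives this step and all steps with larger \<open>j\<close> for the same
  position.\<close>

definition prune :: "nat rel \<Rightarrow> nat \<Rightarrow> nat \<Rightarrow> nat \<Rightarrow> nat set \<Rightarrow> nat set" where
  "prune D b t j S =
     S - {k \<in> S. digit b t k > j \<and> (\<exists>l\<in>S. digit b t l = j \<and> (k, l) \<in> D)}"

definition prune_digit :: "nat rel \<Rightarrow> nat \<Rightarrow> nat \<Rightarrow> nat set \<Rightarrow> nat set" where
  "prune_digit D b t S = fold (prune D b t) [0..<b] S"

definition ruling_set :: "nat rel \<Rightarrow> nat \<Rightarrow> nat \<Rightarrow> nat set \<Rightarrow> nat set" where
  "ruling_set D b m S = fold (prune_digit D b) [0..<m] S"

text \<open>An eliminator is never removed later, so every removed element keeps a surviving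
  witness. A survivor with digit \<open>j\<close> has removed all related elements with larger
  digits in step \<open>j\<close>, so a disagreement can only involve digits not yet
  processed.\<close>

lemma fold_prune:
  fixes b t :: nat and S :: "nat set"
  assumes "sym D" "refl D"
  defines "F \<equiv> \<lambda>j. fold (prune D b t) [0..<j] S"
  shows "F j \<subseteq> S"
    and "k \<in> S \<Longrightarrow> k \<notin> F j \<Longrightarrow> \<exists>l\<in>F j. (k, l) \<in> D \<and> digit b t l < j"
    and "k \<in> F j \<Longrightarrow> l \<in> F j \<Longrightarrow> (k, l) \<in> D \<Longrightarrow> digit b t k < digit b t l \<Longrightarrow> j \<le> digit b t k"
proof (induction j arbitrary: k l)
  case 0
  { case 1 show ?case by (simp add: F_def) }
  { case 2 then show ?case by (simp add: F_def) }
  { case 3 show ?case by simp }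
next
  case (Suc j)
  have F: "F (Suc j) = prune D b t j (F j)"
    by (simp add: F_def)
  { case 1 show ?case using Suc.IH(1) by (auto simp: F prune_def) }
  { case 2
    show ?case
    proof (cases "k \<in> F j")
      case True
      then show ?thesis using 2 by (fastforce simp: F prune_def)
    next
      case False
      then obtain l where "l \<in> F j" "(k, l) \<in> D" "digit b t l < j"
        using Suc.IH(2) 2 by blast
      \<comment> \<open>An element with digit below \<open>j\<close> is not removed in step
        \<open>j\<close>, so the old witness remains.\<close>
      then show ?thesis by (intro bexI[of _ l]) (auto simp: F prune_def)
    qed }
  { case 3
    then have "k \<in> F j" "l \<in> F j" by (auto simp: F prune_def)
    then have "j \<le> digit b t k" using Suc.IH(3) 3 by blast
    moreover have "digit b t k \<noteq> j"
    proof
      assume "digit b t k = j"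
      then have "l \<notin> F (Suc j)"
        using 3 \<open>k \<in> F j\<close> \<open>l \<in> F j\<close> \<open>sym D\<close> by (auto simp: F prune_def dest: symD)
      then show False using 3 by simp
    qed
    ultimately show ?case by simp }
qed

text \<open>All digits are below \<open>b\<close>; after \<open>b\<close> steps the smaller of two
  different digits of related survivors would have to be at least \<open>b\<close>.\<close>

lemma prune_digit:
  assumes D: "sym D" "refl D" and "b > 0"
  shows "prune_digit D b t S \<subseteq> S"
    and "k \<in> S \<Longrightarrow> \<exists>l\<in>prune_digit D b t S. (k, l) \<in> D"
    and "k \<in> prune_digit D b t S \<Longrightarrow> l \<in> prune_digit D b t S \<Longrightarrow> (k, l) \<in> D \<Longrightarrow> digit b t k = digit b t l"
proof -
  show "prune_digit D b t S \<subseteq> S"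
    using fold_prune(1)[OF D] by (simp add: prune_digit_def)
  show "\<exists>l\<in>prune_digit D b t S. (k, l) \<in> D" if "k \<in> S"
    using fold_prune(2)[OF D that, of b t b] \<open>refl D\<close>
    by (metis prune_digit_def refl_onD UNIV_I)
  have *: "\<not> digit b t k < digit b t l"
    if "k \<in> prune_digit D b t S" "l \<in> prune_digit D b t S" "(k, l) \<in> D" for k l
    using fold_prune(3)[OF D, of k b t b S l] that digit_less[OF \<open>b > 0\<close>, of t k]
    by (auto simp: prune_digit_def)
  show "digit b t k = digit b t l"
    if "k \<in> prune_digit D b t S" "l \<in> prune_digit D b t S" "(k, l) \<in> D"
    using *[OF that] *[of l k] that \<open>sym D\<close> by (meson linorder_neqE_nat symD)
qed

text \<open>Each position costs one \<open>D\<close>-step; agreement reached at earlier positions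
  persists because the set only shrinks.\<close>

lemma fold_prune_digit:
  fixes S :: "nat set"
  assumes D: "sym D" "refl D" and "b > 0"
  defines "F \<equiv> \<lambda>m. ruling_set D b m S"
  shows "F m \<subseteq> S"
    and "k \<in> S \<Longrightarrow> \<exists>l\<in>F m. (k, l) \<in> D ^^ m"
    and "k \<in> F m \<Longrightarrow> l \<in> F m \<Longrightarrow> (k, l) \<in> D \<Longrightarrow> t < m \<Longrightarrow> digit b t k = digit b t l"
proof (induction m arbitrary: k l t)
  case 0
  { case 1 show ?case by (simp add: F_def ruling_set_def) }
  { case 2 then show ?case by (simp add: F_def ruling_set_def) }
  { case 3 then show ?case by simp }
next
  case (Suc m)
  have F: "F (Suc m) = prune_digit D b m (F m)"
    by (simp add: F_def ruling_set_def)
  note pd = prune_digit[OF assms(1-3)]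
  { case 1 show ?case using Suc.IH(1) pd(1) by (auto simp: F) }
  { case 2
    then obtain l where l: "l \<in> F m" "(k, l) \<in> D ^^ m" using Suc.IH(2) by blast
    then obtain l' where "l' \<in> F (Suc m)" "(l, l') \<in> D" using pd(2) F by metis
    then show ?case using l by auto }
  { case 3
    then show ?case
      using Suc.IH(3)[of k l t] pd(1,3) by (auto simp: F less_Suc_eq) }
qed

text \<open>Related survivors agree at all \<open>m\<close> positions, and numbers below
  \<open>b ^ m\<close> are determined by these.\<close>

lemma ruling_set:
  assumes "sym D" "refl D" and "b > 0" and "S \<subseteq> {..<b ^ m}"
  shows "ruling_set D b m S \<subseteq> S"
    and "k \<in> S \<Longrightarrow> \<exists>l\<in>ruling_set D b m S. (k, l) \<in> D ^^ m"
    and "k \<in> ruling_set D b m S \<Longrightarrow> l \<in> ruling_set D b m S \<Longrightarrow> (k, l) \<in> D \<Longrightarrow> k = l"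
proof -
  note F = fold_prune_digit[OF assms(1-3), where S = S and m = m]
  show "ruling_set D b m S \<subseteq> S"
    by (rule F(1))
  show "\<exists>l\<in>ruling_set D b m S. (k, l) \<in> D ^^ m" if "k \<in> S"
    using F(2) that .
  show "k = l" if "k \<in> ruling_set D b m S" "l \<in> ruling_set D b m S" "(k, l) \<in> D"
  proof (rule eq_if_digits_eq)
    show "k < b ^ m" "l < b ^ m"
      using that F(1) assms(4) by auto
    show "digit b t k = digit b t l" if "t < m" for t
      using F(3) \<open>k \<in> _\<close> \<open>l \<in> _\<close> \<open>(k, l) \<in> D\<close> that by blast
  qed
qed


section \<open>Flooding inside and between clusters\<close>

lemma sym_relpow: "sym R \<Longrightarrow> sym (R ^^ k)"
proof (induction k)
  case (Suc k)
  then show ?case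
    by (metis converse_relcomp relpow.simps(2) relpow_commute sym_conv_converse_eq)
qed (simp add: sym_Id)

lemma relpow_subset: "(R :: 'a rel) \<subseteq> S \<Longrightarrow> R ^^ k \<subseteq> S ^^ k"
  by (induction k) auto

text \<open>A clustering is a function \<open>c\<close> mapping each vertex to the root of its cluster.\<close>

locale finite_graph =
  fixes V :: "nat set" and E :: "nat set set"
  assumes simple: "simple_graph V E"
begin

lemma edge_in_V: "{u, v} \<in> E \<Longrightarrow> u \<in> V" "{u, v} \<in> E \<Longrightarrow> v \<in> V"
  using simple by (auto simp: simple_graph_def)

lemma finite_V: "finite V"
  using simple by (simp add: simple_graph_def)

lemma finite_nbrs: "finite {u. {u, v} \<in> E}"
  by (rule finite_subset[OF _ finite_V]) (auto dest: edge_in_V)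

definition inner :: "(nat \<Rightarrow> nat) \<Rightarrow> nat rel" where
  "inner c = {(u, w). {u, w} \<in> E \<and> c u = c w}"

text \<open>The path runs inside the cluster. Quantifying over all naturals is harmless: a number
  outside \<open>V\<close> has no edges and can only be a singleton cluster.\<close>

definition good :: "nat \<Rightarrow> (nat \<Rightarrow> nat) \<Rightarrow> bool" where
  "good r c \<longleftrightarrow> (\<forall>v. \<exists>k\<le>r. (c v, v) \<in> inner c ^^ k)"

text \<open>Reflexivity makes the \<open>k\<close>-th power mean cluster distance at most
  \<open>k\<close> instead of walks of length exactly \<open>k\<close>.\<close>

definition cluster_adj :: "(nat \<Rightarrow> nat) \<Rightarrow> nat rel" where
  "cluster_adj c = {(c u, c w) | u w. {u, w} \<in> E}\<^sup>="

definition uniform :: "(nat \<Rightarrow> nat) \<Rightarrow> (nat \<Rightarrow> nat) \<Rightarrow> bool" where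
  "uniform c x \<longleftrightarrow> (\<forall>u v. c u = c v \<longrightarrow> x u = x v)"

lemma sym_inner: "sym (inner c)"
  by (auto simp: inner_def sym_def insert_commute)

lemma sym_cluster_adj: "sym (cluster_adj c)"
  unfolding cluster_adj_def sym_def by (auto simp: insert_commute) (metis insert_commute)

lemma inner_path_same: "(u, v) \<in> inner c ^^ k \<Longrightarrow> c u = c v"
  by (induction k arbitrary: v) (auto simp: inner_def)

lemma good_root: "good r c \<Longrightarrow> c (c v) = c v"
  using inner_path_same unfolding good_def by blast

lemma good_diameter:
  assumes "good r c" "c u = c v"
  shows "\<exists>k\<le>2 * r. (u, v) \<in> inner c ^^ k"
proof -
  obtain i j where "i \<le> r" "(c u, u) \<in> inner c ^^ i" "j \<le> r" "(c v, v) \<in> inner c ^^ j"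
    using assms(1) unfolding good_def by blast
  then have "(u, v) \<in> inner c ^^ (i + j)"
    using assms(2) sym_relpow[OF sym_inner] by (auto simp: relpow_add dest: symD)
  then show ?thesis
    using \<open>i \<le> r\<close> \<open>j \<le> r\<close> by (intro exI[of _ "i + j"]) simp
qed

definition inmax :: "(nat \<Rightarrow> nat) \<Rightarrow> (nat \<Rightarrow> nat) \<Rightarrow> nat \<Rightarrow> nat" where
  "inmax c x v = Max (insert (x v) {x u | u. {u, v} \<in> E \<and> c u = c v})"

text \<open>Keeping a nonzero value prevents a cluster that has been captured from being captured
  again by another center.\<close>

definition outmax :: "(nat \<Rightarrow> nat) \<Rightarrow> nat \<Rightarrow> nat" where
  "outmax x v = (if x v \<noteq> 0 then x v else Max (insert 0 {x u | u. {u, v} \<in> E}))"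

text \<open>\<open>2 * r\<close> bounds the diameter of a cluster of radius \<open>r\<close>, so a
  value that enters through one member can reach all of them.\<close>

definition hood :: "nat \<Rightarrow> (nat \<Rightarrow> nat) \<Rightarrow> (nat \<Rightarrow> nat) \<Rightarrow> nat \<Rightarrow> nat" where
  "hood r c x = (inmax c ^^ (2 * r)) (outmax x)"

lemma finite_nbr_vals: "finite {x u | u. {u, v} \<in> E \<and> P u}"
proof -
  have "{x u | u. {u, v} \<in> E \<and> P u} \<subseteq> x ` {u. {u, v} \<in> E}"
    by blast
  then show ?thesis
    by (rule finite_subset) (rule finite_imageI[OF finite_nbrs])
qed

lemma inmax_in: "\<exists>u. c u = c v \<and> inmax c x v = x u"
proof -
  have "inmax c x v \<in> insert (x v) {x u | u. {u, v} \<in> E \<and> c u = c v}"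
    unfolding inmax_def by (rule Max_in[OF finite.insertI[OF finite_nbr_vals]]) simp
  then show ?thesis by auto
qed

lemma inmax_ge: "x v \<le> inmax c x v" "(u, v) \<in> inner c \<Longrightarrow> x u \<le> inmax c x v"
  unfolding inmax_def inner_def by (auto intro!: Max_ge[OF finite.insertI[OF finite_nbr_vals]])

lemma inmax_pow_in: "\<exists>u. c u = c v \<and> (inmax c ^^ k) x v = x u"
proof (induction k arbitrary: v)
  case (Suc k)
  then show ?case
    using inmax_in[of c v "(inmax c ^^ k) x"] by (metis comp_apply funpow.simps(2))
qed auto

lemma inmax_pow_ge:
  assumes "(u, v) \<in> inner c ^^ j" "j \<le> k"
  shows "x u \<le> (inmax c ^^ k) x v"
  using assms
proof (induction k arbitrary: j v)
  case (Suc k)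
  show ?case
  proof (cases "j \<le> k")
    case True
    then show ?thesis
      using Suc.IH[OF Suc.prems(1)] inmax_ge(1)[of "(inmax c ^^ k) x" v c] by simp
  next
    case False
    then have "j = Suc k"
      using Suc.prems by simp
    then obtain w where "(u, w) \<in> inner c ^^ k" "(w, v) \<in> inner c"
      using Suc.prems by auto
    then show ?thesis
      using Suc.IH[of w k] inmax_ge(2)[of w v c "(inmax c ^^ k) x"] by simp
  qed
qed simp

lemma inmax_flood_ge:
  "good r c \<Longrightarrow> c u = c v \<Longrightarrow> x u \<le> (inmax c ^^ (2 * r)) x v"
  using good_diameter inmax_pow_ge by blast

text \<open>The value a member ends with started in the same cluster and has therefore reached every
  other member, so the maxima of any two members bound each other.\<close>

lemma uniform_inmax_flood: "good r c \<Longrightarrow> uniform c ((inmax c ^^ (2 * r)) x)"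
  unfolding uniform_def
proof (intro allI impI)
  have *: "(inmax c ^^ (2 * r)) x u \<le> (inmax c ^^ (2 * r)) x v" if "good r c" "c u = c v" for u v
  proof -
    obtain w where "c w = c u" "(inmax c ^^ (2 * r)) x u = x w"
      using inmax_pow_in by blast
    then show ?thesis
      using inmax_flood_ge[of r c w v x] that by simp
  qed
  show "(inmax c ^^ (2 * r)) x u = (inmax c ^^ (2 * r)) x v" if "good r c" "c u = c v" for u v
    using *[of u v] *[of v u] that by simp
qed

lemma uniform_hood: "good r c \<Longrightarrow> uniform c (hood r c x)"
  by (simp add: hood_def uniform_inmax_flood)

lemma hood_keep:
  assumes "good r c" "uniform c x" "x v \<noteq> 0"
  shows "hood r c x v = x v"
proof -
  obtain u where u: "c u = c v" "hood r c x v = outmax x u"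
    using inmax_pow_in[of c v "2 * r" "outmax x"] unfolding hood_def by blast
  then have "x u = x v"
    using assms(2) unfolding uniform_def by blast
  then show ?thesis
    using u assms(3) by (simp add: outmax_def)
qed

lemma hood_from:
  assumes "hood r c x v \<noteq> 0"
  shows "\<exists>w. (c v, c w) \<in> cluster_adj c \<and> x w = hood r c x v"
proof -
  obtain u where u: "c u = c v" "hood r c x v = outmax x u"
    using inmax_pow_in[of c v "2 * r" "outmax x"] by (auto simp: hood_def)
  show ?thesis
  proof (cases "x u = 0")
    case False
    then show ?thesis
      using u by (intro exI[of _ u]) (auto simp: outmax_def cluster_adj_def)
  next
    case True
    have "Max (insert 0 {x w | w. {w, u} \<in> E}) \<in> insert 0 {x w | w. {w, u} \<in> E}"
      using Max_in[OF finite.insertI[OF finite_nbr_vals[of x u "\<lambda>_. True"]], of 0] by simp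
    then obtain w where "{w, u} \<in> E" "x w = hood r c x v"
      using True u assms by (auto simp: outmax_def)
    then have "{u, w} \<in> E"
      by (simp add: insert_commute)
    then have "(c u, c w) \<in> cluster_adj c"
      unfolding cluster_adj_def by blast
    then show ?thesis
      using u(1) \<open>x w = hood r c x v\<close> by auto
  qed
qed

text \<open>Neighbouring clusters compete and the maximum wins, so the value that arrives need not
  be \<open>x w\<close>; as 0 is the least value, some nonzero one arrives.\<close>

lemma hood_reaches:
  assumes "good r c" "uniform c x" "(c v, c w) \<in> cluster_adj c" "x w \<noteq> 0"
  shows "hood r c x v \<noteq> 0"
proof (cases "c v = c w")
  case True
  then show ?thesis
    using assms hood_keep[OF assms(1,2), of v] unfolding uniform_def by metis
next
  case False
  then obtain a b where ab: "c v = c a" "c w = c b" "{a, b} \<in> E"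
    using assms(3) by (auto simp: cluster_adj_def)
  then have "x b \<noteq> 0"
    using assms(2,4) unfolding uniform_def by metis
  moreover have "x b \<le> Max (insert 0 {x u | u. {u, a} \<in> E})"
  proof -
    have "{b, a} \<in> E"
      using ab(3) by (simp add: insert_commute)
    then show ?thesis
      using Max_ge[OF finite.insertI[OF finite_nbr_vals[of x a "\<lambda>_. True"]], of "x b" 0] by auto
  qed
  ultimately have "outmax x a \<noteq> 0"
    by (auto simp: outmax_def)
  moreover have "outmax x a \<le> hood r c x v"
    using inmax_flood_ge[OF assms(1), of a v] ab by (simp add: hood_def)
  ultimately show ?thesis
    by simp
qed

lemma hood_nonzero_iff:
  assumes "good r c" "uniform c x"
  shows "hood r c x v \<noteq> 0 \<longleftrightarrow> (\<exists>w. (c v, c w) \<in> cluster_adj c \<and> x w \<noteq> 0)"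
  using hood_from[of r c x v] hood_reaches[OF assms] by metis

end

section \<open>Operations realising the floods and the digit elimination\<close>

definition in_op :: op where
  "in_op st ib = st\<lparr>val := Max (insert (val st) {y. \<exists>w. ib w = Some (cl st, y)})\<rparr>"

definition out_op :: op where
  "out_op st ib = (if val st \<noteq> 0 then st
     else st\<lparr>val := Max (insert 0 {y. \<exists>w k. ib w = Some (k, y)})\<rparr>)"

definition hood_ops :: "nat \<Rightarrow> op list" where
  "hood_ops r = out_op # replicate (2 * r) in_op"

text \<open>Two floods in a row reach cluster distance 2, the relation for which the ruling set is
  formed.\<close>

definition prune_ops :: "nat \<Rightarrow> nat \<Rightarrow> nat \<Rightarrow> nat \<Rightarrow> op list" where
  "prune_ops b r t j =
     [\<lambda>st _. st\<lparr>val := of_bool (cand st \<and> digit b t (cl st) = j)\<rparr>] @ hood_ops r @ hood_ops r @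
     [\<lambda>st _. st\<lparr>cand := cand st \<and> \<not> (digit b t (cl st) > j \<and> val st \<noteq> 0)\<rparr>]"

definition ruling_ops :: "nat \<Rightarrow> nat \<Rightarrow> nat \<Rightarrow> op list" where
  "ruling_ops b m r = concat (map (\<lambda>t. concat (map (prune_ops b r t) [0..<b])) [0..<m])"

context finite_graph
begin

lemma step_in_op:
  "step E in_op \<sigma> = (\<lambda>v. \<sigma> v\<lparr>val := inmax (\<lambda>v. cl (\<sigma> v)) (\<lambda>v. val (\<sigma> v)) v\<rparr>)"
proof
  fix v
  have "{y. \<exists>w. inb E \<sigma> v w = Some (cl (\<sigma> v), y)} =
      {val (\<sigma> u) | u. {u, v} \<in> E \<and> cl (\<sigma> u) = cl (\<sigma> v)}"
    by (auto simp: inb_def split: if_splits)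
  then show "step E in_op \<sigma> v = \<sigma> v\<lparr>val := inmax (\<lambda>v. cl (\<sigma> v)) (\<lambda>v. val (\<sigma> v)) v\<rparr>"
    by (simp add: step_def in_op_def inmax_def)
qed

lemma exec_in_ops:
  "exec E (replicate k in_op) \<sigma> =
     (\<lambda>v. \<sigma> v\<lparr>val := (inmax (\<lambda>v. cl (\<sigma> v)) ^^ k) (\<lambda>v. val (\<sigma> v)) v\<rparr>)"
  by (induction k arbitrary: \<sigma>) (simp_all add: exec_Cons step_in_op funpow_swap1)

lemma step_out_op: "step E out_op \<sigma> = (\<lambda>v. \<sigma> v\<lparr>val := outmax (\<lambda>v. val (\<sigma> v)) v\<rparr>)"
proof
  fix v
  have "{y. \<exists>w k. inb E \<sigma> v w = Some (k, y)} = {val (\<sigma> u) | u. {u, v} \<in> E}"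
    by (auto simp: inb_def split: if_splits)
  then show "step E out_op \<sigma> v = \<sigma> v\<lparr>val := outmax (\<lambda>v. val (\<sigma> v)) v\<rparr>"
    by (simp add: step_def out_op_def outmax_def)
qed

lemma exec_hood_ops:
  "exec E (hood_ops r) \<sigma> =
     (\<lambda>v. \<sigma> v\<lparr>val := hood r (\<lambda>v. cl (\<sigma> v)) (\<lambda>v. val (\<sigma> v)) v\<rparr>)"
  by (simp add: hood_ops_def exec_Cons step_out_op exec_in_ops hood_def)

lemma exec_hood_ops_repeat:
  "exec E (concat (replicate k (hood_ops r))) \<sigma> =
     (\<lambda>v. \<sigma> v\<lparr>val := (hood r (\<lambda>v. cl (\<sigma> v)) ^^ k) (\<lambda>v. val (\<sigma> v)) v\<rparr>)"
  by (induction k arbitrary: \<sigma>) (simp_all add: exec_append exec_hood_ops funpow_swap1)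

text \<open>Candidacy is decided per cluster, hence described by a set \<open>S\<close> of cluster
  names; the existential hides what the floods leave in the register.\<close>

lemma exec_prune_ops:
  fixes \<sigma> :: "nat \<Rightarrow> vstate"
  defines "c \<equiv> \<lambda>v. cl (\<sigma> v)"
  defines "D \<equiv> cluster_adj c O cluster_adj c"
  assumes c: "good r c" and S: "\<forall>v. cand (\<sigma> v) \<longleftrightarrow> c v \<in> S"
  shows "\<exists>x. exec E (prune_ops b r t j) \<sigma> = (\<lambda>v. \<sigma> v\<lparr>val := x v, cand := c v \<in> prune D b t j S\<rparr>)"
proof -
  define x where "x = (\<lambda>v. of_bool (c v \<in> S \<and> digit b t (c v) = j) :: nat)"
  define y where "y = hood r c (hood r c x)"
  have y: "y v \<noteq> 0 \<longleftrightarrow> (\<exists>l\<in>S. digit b t l = j \<and> (c v, l) \<in> D)" for v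
  proof -
    have "uniform c x"
      by (simp add: uniform_def x_def)
    then have "y v \<noteq> 0 \<longleftrightarrow> (\<exists>u w. (c v, c u) \<in> cluster_adj c \<and> (c u, c w) \<in> cluster_adj c \<and> x w \<noteq> 0)"
      unfolding y_def hood_nonzero_iff[OF c uniform_hood[OF c]] hood_nonzero_iff[OF c \<open>uniform c x\<close>]
      by blast
    also have "\<dots> \<longleftrightarrow> (\<exists>l\<in>S. digit b t l = j \<and> (c v, l) \<in> D)"
    proof
      assume "\<exists>l\<in>S. digit b t l = j \<and> (c v, l) \<in> D"
      then obtain k l where l: "l \<in> S" "digit b t l = j" "(c v, k) \<in> cluster_adj c" "(k, l) \<in> cluster_adj c"
        by (auto simp: D_def)
      \<comment> \<open>Both cases of the reflexive closure yield the name of an actual cluster, so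
        the path through \<open>k\<close> is realised by vertices.\<close>
      then obtain u where "k = c u"
        by (auto simp: cluster_adj_def)
      moreover from this l obtain w where "l = c w"
        by (auto simp: cluster_adj_def)
      ultimately show "\<exists>u w. (c v, c u) \<in> cluster_adj c \<and> (c u, c w) \<in> cluster_adj c \<and> x w \<noteq> 0"
        using l by (auto simp: x_def)
    qed (auto simp: D_def x_def)
    finally show ?thesis .
  qed
  have "exec E [\<lambda>st _. st\<lparr>val := of_bool (cand st \<and> digit b t (cl st) = j)\<rparr>] \<sigma> =
      (\<lambda>v. \<sigma> v\<lparr>val := x v\<rparr>)"
    using S by (simp add: exec_Cons step_def x_def c_def)
  moreover have "exec E (hood_ops r @ hood_ops r) (\<lambda>v. \<sigma> v\<lparr>val := x v\<rparr>) = (\<lambda>v. \<sigma> v\<lparr>val := y v\<rparr>)"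
    by (simp add: exec_append exec_hood_ops c_def y_def)
  moreover have "exec E [\<lambda>st _. st\<lparr>cand := cand st \<and> \<not> (digit b t (cl st) > j \<and> val st \<noteq> 0)\<rparr>]
      (\<lambda>v. \<sigma> v\<lparr>val := y v\<rparr>) =
      (\<lambda>v. \<sigma> v\<lparr>val := y v, cand := c v \<in> S \<and> \<not> (digit b t (c v) > j \<and> y v \<noteq> 0)\<rparr>)"
    using S by (simp add: exec_Cons step_def c_def)
  ultimately have "exec E (prune_ops b r t j) \<sigma> =
      (\<lambda>v. \<sigma> v\<lparr>val := y v, cand := c v \<in> S \<and> \<not> (digit b t (c v) > j \<and> y v \<noteq> 0)\<rparr>)"
    by (simp only: prune_ops_def exec_append)
  also have "\<dots> = (\<lambda>v. \<sigma> v\<lparr>val := y v, cand := c v \<in> prune D b t j S\<rparr>)"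
  proof -
    have "(c v \<in> S \<and> \<not> (digit b t (c v) > j \<and> y v \<noteq> 0)) = (c v \<in> prune D b t j S)" for v
      unfolding y prune_def by blast
    then show ?thesis
      by simp
  qed
  finally show ?thesis
    by blast
qed

text \<open>Used twice: for the digit values within a position and for the positions. The hypothesis
  \<open>step\<close> covers every register content because each block leaves an unknown one
  behind.\<close>

lemma exec_fold:
  fixes \<sigma> :: "nat \<Rightarrow> vstate"
  assumes step: "\<And>\<tau> S a. (\<forall>v. cl (\<tau> v) = c v) \<Longrightarrow> \<forall>v. cand (\<tau> v) \<longleftrightarrow> c v \<in> S \<Longrightarrow>
      \<exists>x. exec E (ops a) \<tau> = (\<lambda>v. \<tau> v\<lparr>val := x v, cand := c v \<in> f a S\<rparr>)"
    and "\<forall>v. cl (\<sigma> v) = c v" "\<forall>v. cand (\<sigma> v) \<longleftrightarrow> c v \<in> S"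
  shows "\<exists>x. exec E (concat (map ops as)) \<sigma> = (\<lambda>v. \<sigma> v\<lparr>val := x v, cand := c v \<in> fold f as S\<rparr>)"
  using assms(2,3)
proof (induction as arbitrary: \<sigma> S)
  case Nil
  then show ?case
    by (intro exI[of _ "\<lambda>v. val (\<sigma> v)"]) (auto intro!: vstate.equality)
next
  case (Cons a as)
  obtain x where x: "exec E (ops a) \<sigma> = (\<lambda>v. \<sigma> v\<lparr>val := x v, cand := c v \<in> f a S\<rparr>)"
    using step[OF Cons.prems] by blast
  obtain y where "exec E (concat (map ops as)) (exec E (ops a) \<sigma>) =
      (\<lambda>v. exec E (ops a) \<sigma> v\<lparr>val := y v, cand := c v \<in> fold f as (f a S)\<rparr>)"
    using Cons.IH[of "exec E (ops a) \<sigma>" "f a S"] Cons.prems by (auto simp: x)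
  then show ?case
    by (intro exI[of _ y]) (simp add: exec_append x)
qed

lemma exec_ruling_ops:
  fixes \<sigma> :: "nat \<Rightarrow> vstate"
  defines "c \<equiv> \<lambda>v. cl (\<sigma> v)"
  defines "D \<equiv> cluster_adj c O cluster_adj c"
  assumes c: "good r c" and S: "\<forall>v. cand (\<sigma> v) \<longleftrightarrow> c v \<in> S"
  shows "\<exists>x. exec E (ruling_ops b m r) \<sigma> = (\<lambda>v. \<sigma> v\<lparr>val := x v, cand := c v \<in> ruling_set D b m S\<rparr>)"
proof -
  have 1: "\<exists>x. exec E (prune_ops b r t j) \<tau> = (\<lambda>v. \<tau> v\<lparr>val := x v, cand := c v \<in> prune D b t j S\<rparr>)"
    if "\<forall>v. cl (\<tau> v) = c v" "\<forall>v. cand (\<tau> v) \<longleftrightarrow> c v \<in> S" for \<tau> S t j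
    using exec_prune_ops[of r \<tau> S b t j] that c by (simp add: D_def)
  have 2: "\<exists>x. exec E (concat (map (prune_ops b r t) [0..<b])) \<tau> =
      (\<lambda>v. \<tau> v\<lparr>val := x v, cand := c v \<in> prune_digit D b t S\<rparr>)"
    if "\<forall>v. cl (\<tau> v) = c v" "\<forall>v. cand (\<tau> v) \<longleftrightarrow> c v \<in> S" for \<tau> S t
    unfolding prune_digit_def by (rule exec_fold[OF _ that]) (erule (1) 1)
  have C: "\<forall>v. cl (\<sigma> v) = c v"
    by (simp add: c_def)
  show ?thesis
    unfolding ruling_ops_def ruling_set_def by (rule exec_fold[OF _ C S]) (erule (1) 2)
qed

end


section \<open>One superclustering phase\<close>

text \<open>It is run when the register holds the live bit, so \<open>A\<close> consists of the
  neighbouring live clusters. \<open>LEAST\<close> makes the choice of an edge to each of them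
  deterministic.\<close>

definition dense_op :: "real \<Rightarrow> op" where
  "dense_op \<theta> st ib = (let A = {k. \<exists>w y. ib w = Some (k, y) \<and> y \<noteq> 0} in
     if live st \<and> real (card (insert (cl st) A)) > \<theta> then st\<lparr>val := 1\<rparr>
     else st\<lparr>val := 0, live := False, sel := if live st
       then (\<lambda>k. LEAST w. \<exists>y. ib w = Some (k, y) \<and> y \<noteq> 0) ` (A - {cl st}) else sel st\<rparr>)"

text \<open>The register holds in turn the survival bit, the elimination bit and the name of the
  capturing center, and ends as the live bit expected by the next \<open>dense_op\<close>. The
  centers dominate within cluster distance \<open>2 * m\<close>, hence that many capture
  rounds.\<close>

definition phase_ops :: "nat \<Rightarrow> nat \<Rightarrow> nat \<Rightarrow> real \<Rightarrow> op list" where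
  "phase_ops b m r \<theta> = dense_op \<theta> # replicate (2 * r) in_op @ [\<lambda>st _. st\<lparr>cand := val st \<noteq> 0\<rparr>] @
     ruling_ops b m r @ [\<lambda>st _. st\<lparr>val := if cand st then cl st else 0\<rparr>] @
     concat (replicate (2 * m) (hood_ops r)) @
     [\<lambda>st _. st\<lparr>cl := if val st \<noteq> 0 then val st else cl st, val := of_bool (live st)\<rparr>]"

context finite_graph
begin

definition adj_clusters :: "(nat \<Rightarrow> nat) \<Rightarrow> nat set \<Rightarrow> nat \<Rightarrow> nat set" where
  "adj_clusters c L v = c ` {w. {w, v} \<in> E \<and> w \<in> L}"

definition dense :: "real \<Rightarrow> (nat \<Rightarrow> nat) \<Rightarrow> nat set \<Rightarrow> nat set" where
  "dense \<theta> c L = {v \<in> L. real (card (insert (c v) (adj_clusters c L v))) > \<theta>}"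

definition picks :: "(nat \<Rightarrow> nat) \<Rightarrow> nat set \<Rightarrow> nat \<Rightarrow> nat set" where
  "picks c L v = (\<lambda>k. LEAST w. {w, v} \<in> E \<and> w \<in> L \<and> c w = k) ` (adj_clusters c L v - {c v})"

definition centers :: "nat \<Rightarrow> nat \<Rightarrow> (nat \<Rightarrow> nat) \<Rightarrow> nat set \<Rightarrow> nat set" where
  "centers b m c A = ruling_set (cluster_adj c O cluster_adj c) b m (c ` A)"

definition captured :: "nat \<Rightarrow> nat \<Rightarrow> (nat \<Rightarrow> nat) \<Rightarrow> nat set \<Rightarrow> nat \<Rightarrow> nat" where
  "captured t r c S = (hood r c ^^ t) (\<lambda>v. if c v \<in> S then c v else 0)"

definition merge :: "nat \<Rightarrow> nat \<Rightarrow> nat \<Rightarrow> (nat \<Rightarrow> nat) \<Rightarrow> nat set \<Rightarrow> nat \<Rightarrow> nat" where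
  "merge b m r c A v = (let k = captured (2 * m) r c (centers b m c A) v in if k \<noteq> 0 then k else c v)"

text \<open>Demanding a nonzero value makes this relation grow with each capture round; two empty
  registers could still be filled differently later.\<close>

definition inner_pos :: "(nat \<Rightarrow> nat) \<Rightarrow> nat rel" where
  "inner_pos x = {(u, w). {u, w} \<in> E \<and> x u = x w \<and> x u \<noteq> 0}"

text \<open>Names of clusters of vertices are thus IDs of vertices, so the bound on the IDs also
  bounds the numbers given to the ruling set.\<close>

lemma good_root_in_V:
  assumes "good r c" "v \<in> V"
  shows "c v \<in> V"
proof -
  obtain k where k: "(c v, v) \<in> inner c ^^ k"
    using assms(1) unfolding good_def by blast
  show ?thesis
  proof (cases k)
    case (Suc j)
    then obtain y where "(c v, y) \<in> inner c"
      using k relpow_Suc_D2 by metis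
    then show ?thesis
      using edge_in_V(1)[of "c v" y] by (simp add: inner_def)
  qed (use k assms(2) in auto)
qed

lemma inner_path_pos:
  assumes "uniform c x" "x u \<noteq> 0" "(u, v) \<in> inner c ^^ k"
  shows "(u, v) \<in> inner_pos x ^^ k"
  using assms(3)
proof (induction k arbitrary: v)
  case (Suc k)
  then obtain w where w: "(u, w) \<in> inner c ^^ k" "(w, v) \<in> inner c"
    by auto
  then have "c u = c w" "c w = c v" "{w, v} \<in> E"
    using inner_path_same[OF w(1)] by (simp_all add: inner_def)
  moreover from this have "x u = x w" "x w = x v"
    using assms(1) unfolding uniform_def by blast+
  ultimately have "(w, v) \<in> inner_pos x"
    using assms(2) by (simp add: inner_pos_def)
  then show ?case
    using Suc.IH w by auto
qed simp

lemma captured_0: "captured 0 r c S v = (if c v \<in> S then c v else 0)"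
  and captured_Suc: "captured (Suc t) r c S = hood r c (captured t r c S)"
  by (simp_all add: captured_def)

lemma uniform_captured: "good r c \<Longrightarrow> uniform c (captured t r c S)"
  by (cases t) (simp_all add: captured_Suc uniform_hood, simp add: uniform_def captured_0)

lemma captured_keep: "good r c \<Longrightarrow> captured t r c S v \<noteq> 0 \<Longrightarrow> captured (Suc t) r c S v = captured t r c S v"
  using hood_keep uniform_captured by (simp add: captured_Suc)

lemma captured_in: "captured t r c S v \<noteq> 0 \<Longrightarrow> captured t r c S v \<in> S"
proof (induction t arbitrary: v)
  case (Suc t)
  then show ?case
    using hood_from[of r c "captured t r c S" v] by (metis captured_Suc)
qed (simp add: captured_0 split: if_splits)

text \<open>One capture round bridges one step of cluster adjacency. Zero must not be a center
  because it marks an empty register.\<close>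

lemma captured_reaches:
  assumes c: "good r c" and "0 \<notin> S"
  shows "(c v, c w) \<in> cluster_adj c ^^ t \<Longrightarrow> c w \<in> S \<Longrightarrow> captured t r c S v \<noteq> 0"
proof (induction t arbitrary: v)
  case 0
  then show ?case
    using \<open>0 \<notin> S\<close> by (cases "c w = 0") (auto simp: captured_0)
next
  case (Suc t)
  then obtain k where k: "(c v, k) \<in> cluster_adj c" "(k, c w) \<in> cluster_adj c ^^ t"
    using relpow_Suc_D2 by meson
  then obtain u where "k = c u"
    by (auto simp: cluster_adj_def)
  then show ?case
    using hood_reaches[OF c uniform_captured[OF c]] Suc k by (metis captured_Suc)
qed

text \<open>The start costs \<open>r\<close>, and each capture round adds one edge between clusters
  plus at most \<open>2 * r\<close> inside the newly captured cluster.\<close>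

lemma captured_radius:
  assumes c: "good r c" and "0 \<notin> S" and "captured t r c S v \<noteq> 0"
  shows "\<exists>k\<le>r + t * (2 * r + 1). (captured t r c S v, v) \<in> inner_pos (captured t r c S) ^^ k"
  using assms(3)
proof (induction t arbitrary: v)
  case 0
  let ?x = "captured 0 r c S"
  have v: "c v \<in> S" "?x v = c v"
    using 0 by (auto simp: captured_0 split: if_splits)
  obtain k where k: "k \<le> r" "(c v, v) \<in> inner c ^^ k"
    using c unfolding good_def by blast
  have "?x (c v) \<noteq> 0"
    using v(1) \<open>0 \<notin> S\<close> good_root[OF c] by (cases "c v = 0") (auto simp: captured_0)
  then have "(c v, v) \<in> inner_pos ?x ^^ k"
    using inner_path_pos[OF uniform_captured[OF c] _ k(2)] by blast
  then show ?case
    using v k by auto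
next
  case (Suc t)
  let ?x = "captured t r c S" and ?y = "captured (Suc t) r c S"
  note keep = captured_keep[OF c, of t S]
  have mono: "inner_pos ?x \<subseteq> inner_pos ?y"
    using keep by (auto simp: inner_pos_def)
  show ?case
  proof (cases "?x v = 0")
    case False
    then obtain k where "k \<le> r + t * (2 * r + 1)" "(?x v, v) \<in> inner_pos ?x ^^ k"
      using Suc.IH by blast
    then show ?thesis
      using keep[OF False] relpow_subset[OF mono, of k] by (intro exI[of _ k]) auto
  next
    case True
    obtain w where w: "(c v, c w) \<in> cluster_adj c" "?x w = ?y v"
      using hood_from[of r c ?x v] Suc.prems by (auto simp: captured_Suc)
    \<comment> \<open>Captured and uncaptured vertices cannot share a cluster, so the adjacency is
      due to an actual edge.\<close>
    moreover have "c v \<noteq> c w"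
      using True Suc.prems w(2) uniform_captured[OF c, of t S] unfolding uniform_def by metis
    ultimately obtain a b where ab: "c v = c a" "c w = c b" "{a, b} \<in> E"
      by (auto simp: cluster_adj_def)
    have x: "?x b = ?y v" "?y a = ?y v"
      using w(2) ab uniform_captured[OF c] unfolding uniform_def by metis+
    then have y: "?y b = ?y v"
      using keep Suc.prems by metis
    obtain k where k: "k \<le> r + t * (2 * r + 1)" "(?y v, b) \<in> inner_pos ?x ^^ k"
      using Suc.IH[of b] Suc.prems x by auto
    have "(?y v, b) \<in> inner_pos ?y ^^ k"
      using relpow_subset[OF mono] k(2) by blast
    moreover have "(b, a) \<in> inner_pos ?y"
      using x y ab Suc.prems by (simp add: inner_pos_def insert_commute)
    moreover obtain j where j: "j \<le> 2 * r" "(a, v) \<in> inner c ^^ j"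
      using good_diameter[OF c, of a v] ab by auto
    moreover have "(a, v) \<in> inner_pos ?y ^^ j"
      using inner_path_pos[OF uniform_captured[OF c] _ j(2)] x(2) Suc.prems by metis
    \<comment> \<open>The path leads from the center to \<open>b\<close>, across to
      \<open>a\<close>, and on to \<open>v\<close> inside its old cluster.\<close>
    ultimately have "(?y v, v) \<in> inner_pos ?y ^^ (Suc k + j)"
      unfolding relpow_add by (blast intro: relpow_Suc_I)
    then show ?thesis
      using j k by (intro exI[of _ "Suc k + j"]) auto
  qed
qed

lemma merge_coarser: "good r c \<Longrightarrow> c u = c v \<Longrightarrow> merge b m r c A u = merge b m r c A v"
  using uniform_captured[of r c "2 * m" "centers b m c A"] unfolding uniform_def merge_def by metis

text \<open>The relation \<open>?D\<close> is the square of cluster adjacency: domination within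
  \<open>m\<close> of its steps means cluster distance at most \<open>2 * m\<close>, and
  independence means that no two centers share a neighbour.\<close>

lemma centers:
  assumes "b > 0" "c ` A \<subseteq> {..<b ^ m}"
  shows "centers b m c A \<subseteq> c ` A"
    and "k \<in> c ` A \<Longrightarrow> \<exists>l\<in>centers b m c A. (k, l) \<in> cluster_adj c ^^ (2 * m)"
    and "k \<in> centers b m c A \<Longrightarrow> l \<in> centers b m c A \<Longrightarrow> (k, h) \<in> cluster_adj c \<Longrightarrow>
      (l, h) \<in> cluster_adj c \<Longrightarrow> k = l"
proof -
  let ?D = "cluster_adj c O cluster_adj c"
  have D: "sym ?D" "refl ?D"
    using sym_cluster_adj[of c]
    by (metis converse_relcomp sym_conv_converse_eq, auto simp: cluster_adj_def refl_on_def)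
  have pow: "?D ^^ m = cluster_adj c ^^ (2 * m)"
    by (induction m) (simp_all add: O_assoc relpow_commute)
  note R = ruling_set[OF D assms, folded centers_def]
  show "centers b m c A \<subseteq> c ` A"
    by (rule R(1))
  show "\<exists>l\<in>centers b m c A. (k, l) \<in> cluster_adj c ^^ (2 * m)" if "k \<in> c ` A"
    using R(2)[OF that] pow by simp
  show "k = l" if "k \<in> centers b m c A" "l \<in> centers b m c A" "(k, h) \<in> cluster_adj c" "(l, h) \<in> cluster_adj c"
    using R(3)[OF that(1,2)] that(3,4) sym_cluster_adj by (blast dest: symD)
qed

text \<open>For a captured vertex the path from \<open>captured_radius\<close> stays in the merged
  cluster, since equal nonzero registers give equal new names. Any other vertex keeps its old name
  and path, as merging only coarsens.\<close>

lemma good_merge: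
  assumes "b > 0" "c ` A \<subseteq> {0<..<b ^ m}" and c: "good r c"
  shows "good (r + 2 * m * (2 * r + 1)) (merge b m r c A)"
  unfolding good_def
proof
  fix v
  let ?c = "merge b m r c A" and ?S = "centers b m c A"
  let ?x = "captured (2 * m) r c ?S"
  have S: "0 \<notin> ?S"
    using centers(1)[of b c A m] assms(1,2) by fastforce
  show "\<exists>k\<le>r + 2 * m * (2 * r + 1). (?c v, v) \<in> inner ?c ^^ k"
  proof (cases "?x v = 0")
    case False
    have sub: "inner_pos ?x \<subseteq> inner ?c"
      by (auto simp: inner_pos_def inner_def merge_def)
    obtain k where "k \<le> r + 2 * m * (2 * r + 1)" "(?x v, v) \<in> inner_pos ?x ^^ k"
      using captured_radius[OF c S False] by blast
    moreover have "?c v = ?x v"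
      using False by (simp add: merge_def)
    ultimately show ?thesis
      using relpow_subset[OF sub, of k] by (intro exI[of _ k]) auto
  next
    case True
    have sub: "inner c \<subseteq> inner ?c"
      using merge_coarser[OF c] unfolding inner_def by blast
    obtain k where "k \<le> r" "(c v, v) \<in> inner c ^^ k"
      using c unfolding good_def by blast
    moreover have "?c v = c v"
      using True by (simp add: merge_def)
    ultimately show ?thesis
      using relpow_subset[OF sub, of k] by (intro exI[of _ k]) auto
  qed
qed

text \<open>The domination distance equals the number of capture rounds, so no cluster with a
  surviving vertex is missed. Hence the centers bound the number of live clusters after the
  phase.\<close>

lemma merge_in_centers:
  assumes "b > 0" "c ` A \<subseteq> {0<..<b ^ m}" and c: "good r c" and "v \<in> A"
  shows "merge b m r c A v \<in> centers b m c A"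
proof -
  let ?S = "centers b m c A"
  have A: "c ` A \<subseteq> {..<b ^ m}"
    using assms(2) by auto
  have S: "0 \<notin> ?S"
    using centers(1)[OF assms(1) A] assms(2) by fastforce
  obtain l where "l \<in> ?S" "(c v, l) \<in> cluster_adj c ^^ (2 * m)"
    using centers(2)[OF assms(1) A] assms(4) by blast
  moreover then obtain w where "l = c w"
    using centers(1)[OF assms(1) A] by blast
  ultimately have "captured (2 * m) r c ?S v \<noteq> 0"
    using captured_reaches[OF c S] by blast
  then show ?thesis
    using captured_in by (simp add: merge_def)
qed

text \<open>A vertex without edges sees only its own cluster, and 1 does not exceed
  \<open>\<theta>\<close>. So the numbers outside \<open>V\<close> die in the first phase.\<close>

lemma dense_in_V:
  assumes "\<theta> \<ge> 1"
  shows "dense \<theta> c L \<subseteq> V"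
proof
  fix v assume "v \<in> dense \<theta> c L"
  then have "card (insert (c v) (adj_clusters c L v)) > 1"
    using assms by (auto simp: dense_def)
  then have "adj_clusters c L v \<noteq> {}"
    by auto
  then show "v \<in> V"
    using edge_in_V(2) by (auto simp: adj_clusters_def)
qed

lemma nbr_clusters: "adj_clusters c L v \<subseteq> c ` (L \<inter> V)"
  unfolding adj_clusters_def using edge_in_V(1) by blast

text \<open>Distinct centers have disjoint neighbourhoods in the cluster graph, each containing more than
  \<open>\<theta>\<close> live clusters.\<close>

lemma card_centers:
  assumes "b > 0" "c ` dense \<theta> c L \<subseteq> {..<b ^ m}" "\<theta> \<ge> 1"
  shows "real (card (centers b m c (dense \<theta> c L))) * \<theta> \<le> real (card (c ` (L \<inter> V)))"
proof -
  let ?S = "centers b m c (dense \<theta> c L)"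
  define N where "N = (\<lambda>v. insert (c v) (adj_clusters c L v))"
  have "\<exists>v. v \<in> dense \<theta> c L \<and> c v = s" if "s \<in> ?S" for s
    using centers(1)[OF assms(1,2)] that by blast
  then obtain f where f: "\<And>s. s \<in> ?S \<Longrightarrow> f s \<in> dense \<theta> c L" "\<And>s. s \<in> ?S \<Longrightarrow> c (f s) = s"
    by metis
  have L: "finite (c ` (L \<inter> V))"
    using finite_V by blast
  have D: "dense \<theta> c L \<subseteq> L \<inter> V"
    using dense_in_V[OF assms(3)] by (auto simp: dense_def)
  have N: "N v \<subseteq> c ` (L \<inter> V)" if "v \<in> dense \<theta> c L" for v
    using nbr_clusters D that unfolding N_def by blast
  have adj: "(c v, k) \<in> cluster_adj c" if "k \<in> N v" for k v
  proof -
    have "(c v, c w) \<in> cluster_adj c" if "{w, v} \<in> E" for w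
    proof -
      have "{v, w} \<in> E" using that by (simp add: insert_commute)
      then show ?thesis unfolding cluster_adj_def by blast
    qed
    then show ?thesis
      using that by (auto simp: N_def adj_clusters_def) (simp add: cluster_adj_def)
  qed
  have "?S \<subseteq> c ` (L \<inter> V)"
    using centers(1)[OF assms(1,2)] D by blast
  then have S: "finite ?S"
    using L finite_subset by blast
  have disj: "N (f s) \<inter> N (f s') = {}" if "s \<in> ?S" "s' \<in> ?S" "s \<noteq> s'" for s s'
    using centers(3)[OF assms(1,2) that(1,2)] adj[of _ "f s"] adj[of _ "f s'"] f(2) that by fastforce
  have "real (card ?S) * \<theta> = (\<Sum>s\<in>?S. \<theta>)"
    by simp
  also have "\<dots> \<le> (\<Sum>s\<in>?S. real (card (N (f s))))"
    using f(1) by (intro sum_mono) (fastforce simp: dense_def N_def)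
  also have "\<dots> = real (card (\<Union>s\<in>?S. N (f s)))"
  proof (subst card_UN_disjoint)
    show "\<forall>s\<in>?S. finite (N (f s))"
      using N f(1) L finite_subset by metis
    show "\<forall>s\<in>?S. \<forall>s'\<in>?S. s \<noteq> s' \<longrightarrow> N (f s) \<inter> N (f s') = {}"
      using disj by blast
  qed (use S in auto)
  also have "\<dots> \<le> real (card (c ` (L \<inter> V)))"
    using N f(1) by (intro of_nat_mono card_mono[OF L]) blast
  finally show ?thesis .
qed

lemma finite_adj_clusters: "finite (adj_clusters c L v)"
  unfolding adj_clusters_def by (rule finite_imageI, rule finite_subset[OF _ finite_nbrs[of v]]) auto

lemma pick_props:
  assumes "k \<in> adj_clusters c L v"
  defines "w \<equiv> LEAST w. {w, v} \<in> E \<and> w \<in> L \<and> c w = k"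
  shows "{w, v} \<in> E" "c w = k"
proof -
  have "\<exists>w. {w, v} \<in> E \<and> w \<in> L \<and> c w = k"
    using assms(1) by (auto simp: adj_clusters_def)
  from LeastI_ex[OF this] show "{w, v} \<in> E" "c w = k"
    by (simp_all add: w_def)
qed

lemma picks_nbrs: "picks c L v \<subseteq> {w. {w, v} \<in> E}"
  using pick_props(1) by (auto simp: picks_def)

text \<open>The own cluster counts towards the threshold but receives no edge; this saves the one
  edge later spent on the parent in the spanning tree.\<close>

lemma card_picks:
  assumes "v \<in> L" "v \<notin> dense \<theta> c L"
  shows "real (card (picks c L v)) \<le> \<theta> - 1"
proof -
  have "card (picks c L v) \<le> card (adj_clusters c L v - {c v})"
    unfolding picks_def by (intro card_image_le) (simp add: finite_adj_clusters)
  moreover have "card (insert (c v) (adj_clusters c L v)) = Suc (card (adj_clusters c L v - {c v}))"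
    by (simp add: card.insert_remove finite_adj_clusters)
  ultimately show ?thesis
    using assms by (auto simp: dense_def)
qed

lemma picks_cover:
  assumes "{w, v} \<in> E" "w \<in> L" "c w \<noteq> c v"
  shows "\<exists>u\<in>picks c L v. c u = c w"
proof -
  have "c w \<in> adj_clusters c L v - {c v}"
    using assms by (auto simp: adj_clusters_def)
  then show ?thesis
    using pick_props(2)[of "c w" c L v] by (auto simp: picks_def)
qed

lemma step_dense_op:
  fixes \<sigma> :: "nat \<Rightarrow> vstate"
  defines "c \<equiv> \<lambda>v. cl (\<sigma> v)" and "L \<equiv> {v. live (\<sigma> v)}"
  assumes val: "\<forall>v. val (\<sigma> v) = of_bool (live (\<sigma> v))"
  shows "step E (dense_op \<theta>) \<sigma> = (\<lambda>v. \<sigma> v\<lparr>val := of_bool (v \<in> dense \<theta> c L), live := v \<in> dense \<theta> c L,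
    sel := if v \<in> L - dense \<theta> c L then picks c L v else sel (\<sigma> v)\<rparr>)"
proof
  fix v
  let ?ib = "inb E \<sigma> v"
  have ib: "(\<exists>y. ?ib w = Some (k, y) \<and> y \<noteq> 0) \<longleftrightarrow> {w, v} \<in> E \<and> w \<in> L \<and> c w = k" for w k
    using val by (auto simp: inb_def c_def L_def split: if_splits)
  have A: "{k. \<exists>w y. ?ib w = Some (k, y) \<and> y \<noteq> 0} = adj_clusters c L v"
    unfolding ib adj_clusters_def by blast
  have P: "(\<lambda>k. LEAST w. \<exists>y. ?ib w = Some (k, y) \<and> y \<noteq> 0) =
      (\<lambda>k. LEAST w. {w, v} \<in> E \<and> w \<in> L \<and> c w = k)"
    unfolding ib ..
  show "step E (dense_op \<theta>) \<sigma> v = \<sigma> v\<lparr>val := of_bool (v \<in> dense \<theta> c L), live := v \<in> dense \<theta> c L,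
    sel := if v \<in> L - dense \<theta> c L then picks c L v else sel (\<sigma> v)\<rparr>"
    unfolding step_def dense_op_def Let_def A P
    by (auto simp: dense_def c_def L_def picks_def intro!: vstate.equality)
qed

lemma exec_phase_ops:
  fixes \<sigma> :: "nat \<Rightarrow> vstate" and \<theta> :: real
  defines "c \<equiv> \<lambda>v. cl (\<sigma> v)" and "L \<equiv> {v. live (\<sigma> v)}"
  defines "D \<equiv> dense \<theta> c L"
  assumes val: "\<forall>v. val (\<sigma> v) = of_bool (live (\<sigma> v))" and c: "good r c"
  shows "\<exists>z. exec E (phase_ops b m r \<theta>) \<sigma> = (\<lambda>v. \<sigma> v\<lparr>cl := merge b m r c D v,
    val := of_bool (v \<in> D), live := v \<in> D, cand := z v,
    sel := if v \<in> L - D then picks c L v else sel (\<sigma> v)\<rparr>)"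
proof -
  define s where "s = (\<lambda>v. if v \<in> L - D then picks c L v else sel (\<sigma> v))"
  \<comment> \<open>After \<open>dense_op\<close> the fields \<open>live\<close> and
    \<open>sel\<close> are final for the phase; the remaining operations change only
    \<open>val\<close>, \<open>cand\<close> and, at the end, \<open>cl\<close>.\<close>
  define \<tau> where "\<tau> = (\<lambda>v. \<sigma> v\<lparr>live := v \<in> D, sel := s v\<rparr>)"
  define x where "x = (inmax c ^^ (2 * r)) (\<lambda>v. of_bool (v \<in> D))"
  have x: "x v \<noteq> 0 \<longleftrightarrow> c v \<in> c ` D" for v
  proof
    assume "x v \<noteq> 0"
    moreover obtain u where "c u = c v" "x v = of_bool (u \<in> D)"
      using inmax_pow_in[of c v "2 * r" "\<lambda>v. of_bool (v \<in> D)"] unfolding x_def by blast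
    ultimately show "c v \<in> c ` D"
      by (cases "u \<in> D") (auto intro!: image_eqI[of _ _ u])
  next
    assume "c v \<in> c ` D"
    then obtain u where "c u = c v" "u \<in> D"
      by force
    then show "x v \<noteq> 0"
      using inmax_flood_ge[OF c, of u v "\<lambda>v. of_bool (v \<in> D)"] unfolding x_def by simp
  qed
  have 1: "step E (dense_op \<theta>) \<sigma> = (\<lambda>v. \<tau> v\<lparr>val := of_bool (v \<in> D)\<rparr>)"
    unfolding step_dense_op[OF val] \<tau>_def s_def D_def c_def L_def by (intro ext) simp
  have 2: "exec E (replicate (2 * r) in_op) (\<lambda>v. \<tau> v\<lparr>val := of_bool (v \<in> D)\<rparr>) = (\<lambda>v. \<tau> v\<lparr>val := x v\<rparr>)"
    unfolding exec_in_ops x_def c_def \<tau>_def by simp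
  have 3: "exec E [\<lambda>st _. st\<lparr>cand := val st \<noteq> 0\<rparr>] (\<lambda>v. \<tau> v\<lparr>val := x v\<rparr>) =
      (\<lambda>v. \<tau> v\<lparr>val := x v, cand := c v \<in> c ` D\<rparr>)"
    using x by (simp add: exec_Cons step_def)
  obtain y where 4: "exec E (ruling_ops b m r) (\<lambda>v. \<tau> v\<lparr>val := x v, cand := c v \<in> c ` D\<rparr>) =
      (\<lambda>v. \<tau> v\<lparr>val := y v, cand := c v \<in> centers b m c D\<rparr>)"
    using exec_ruling_ops[of r "\<lambda>v. \<tau> v\<lparr>val := x v, cand := c v \<in> c ` D\<rparr>" "c ` D" b m] c
    by (auto simp: centers_def \<tau>_def c_def)
  have 5: "exec E [\<lambda>st _. st\<lparr>val := if cand st then cl st else 0\<rparr>]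
      (\<lambda>v. \<tau> v\<lparr>val := y v, cand := c v \<in> centers b m c D\<rparr>) =
      (\<lambda>v. \<tau> v\<lparr>val := captured 0 r c (centers b m c D) v, cand := c v \<in> centers b m c D\<rparr>)"
    by (intro ext vstate.equality) (simp_all add: exec_Cons step_def captured_0 \<tau>_def c_def)
  have 6: "exec E (concat (replicate (2 * m) (hood_ops r)))
      (\<lambda>v. \<tau> v\<lparr>val := captured 0 r c (centers b m c D) v, cand := c v \<in> centers b m c D\<rparr>) =
      (\<lambda>v. \<tau> v\<lparr>val := captured (2 * m) r c (centers b m c D) v, cand := c v \<in> centers b m c D\<rparr>)"
    unfolding exec_hood_ops_repeat
    by (intro ext vstate.equality) (simp_all add: captured_def \<tau>_def c_def)
  have 7: "exec E [\<lambda>st _. st\<lparr>cl := if val st \<noteq> 0 then val st else cl st, val := of_bool (live st)\<rparr>]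
      (\<lambda>v. \<tau> v\<lparr>val := captured (2 * m) r c (centers b m c D) v, cand := c v \<in> centers b m c D\<rparr>) =
      (\<lambda>v. \<tau> v\<lparr>cl := merge b m r c D v, val := of_bool (v \<in> D), cand := c v \<in> centers b m c D\<rparr>)"
    by (intro ext vstate.equality) (simp_all add: exec_Cons step_def merge_def Let_def \<tau>_def c_def)
  have "exec E (phase_ops b m r \<theta>) \<sigma> =
      (\<lambda>v. \<tau> v\<lparr>cl := merge b m r c D v, val := of_bool (v \<in> D), cand := c v \<in> centers b m c D\<rparr>)"
    unfolding phase_ops_def exec_Cons[of E "dense_op \<theta>"] 1 exec_append 2 3 4 5 6 7 ..
  also have "\<dots> = (\<lambda>v. \<sigma> v\<lparr>cl := merge b m r c D v, val := of_bool (v \<in> D), live := v \<in> D,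
      cand := c v \<in> centers b m c D, sel := s v\<rparr>)"
    by (intro ext vstate.equality) (simp_all add: \<tau>_def)
  finally show ?thesis
    unfolding s_def by (rule exI[of _ "\<lambda>v. c v \<in> centers b m c D"])
qed

end


section \<open>The invariant of the phases\<close>

context finite_graph
begin

definition covered :: "(nat \<Rightarrow> vstate) \<Rightarrow> nat \<Rightarrow> nat \<Rightarrow> bool" where
  "covered \<sigma> u v \<longleftrightarrow> cl (\<sigma> u) = cl (\<sigma> v) \<or> (\<exists>w\<in>sel (\<sigma> u). cl (\<sigma> w) = cl (\<sigma> v))"

text \<open>A live vertex has selected nothing yet, so each vertex selects in one phase only and
  \<open>\<theta> - 1\<close> bounds its total. An edge either still joins live vertices or is
  settled from one end. The last conjunct records the loss of a factor \<open>\<theta>\<close> per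
  phase.\<close>

definition phase_inv :: "real \<Rightarrow> nat \<Rightarrow> nat \<Rightarrow> (nat \<Rightarrow> vstate) \<Rightarrow> bool" where
  "phase_inv \<theta> r i \<sigma> \<longleftrightarrow> good r (\<lambda>v. cl (\<sigma> v)) \<and>
     (\<forall>v. vid (\<sigma> v) = v \<and> val (\<sigma> v) = of_bool (live (\<sigma> v)) \<and> (live (\<sigma> v) \<longrightarrow> sel (\<sigma> v) = {}) \<and>
       sel (\<sigma> v) \<subseteq> {w. {w, v} \<in> E} \<and> real (card (sel (\<sigma> v))) \<le> \<theta> - 1) \<and>
     (\<forall>u v. {u, v} \<in> E \<longrightarrow> live (\<sigma> u) \<and> live (\<sigma> v) \<or> covered \<sigma> u v \<or> covered \<sigma> v u) \<and>
     real (card ((\<lambda>v. cl (\<sigma> v)) ` ({v. live (\<sigma> v)} \<inter> V))) * \<theta> ^ i \<le> real (card V)"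

lemma phase_inv_init: "\<theta> \<ge> 1 \<Longrightarrow> phase_inv \<theta> 0 0 init"
  by (auto simp: phase_inv_def init_def good_def)

lemma covered_mono:
  assumes "covered \<sigma> u v" "sel (\<sigma> u) \<subseteq> sel (\<tau> u)"
    and "\<And>x y. cl (\<sigma> x) = cl (\<sigma> y) \<Longrightarrow> cl (\<tau> x) = cl (\<tau> y)"
  shows "covered \<tau> u v"
  using assms unfolding covered_def by blast

text \<open>A dying vertex selects an edge to every other live cluster next to it, even if the far
  end dies in the same phase. The new clusters enter only as a coarsening of the old ones, so the
  lemma serves both a full phase and the final step without merging.\<close>

lemma covered_after_dense:
  fixes \<sigma> \<tau> :: "nat \<Rightarrow> vstate" and \<theta> :: real
  defines "L \<equiv> {v. live (\<sigma> v)}"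
  defines "D \<equiv> dense \<theta> (\<lambda>v. cl (\<sigma> v)) L"
  assumes inv: "phase_inv \<theta> r i \<sigma>" and e: "{u, v} \<in> E"
    and sel: "\<And>v. sel (\<tau> v) = (if v \<in> L - D then picks (\<lambda>v. cl (\<sigma> v)) L v else sel (\<sigma> v))"
    and cl: "\<And>x y. cl (\<sigma> x) = cl (\<sigma> y) \<Longrightarrow> cl (\<tau> x) = cl (\<tau> y)"
  shows "u \<in> D \<and> v \<in> D \<or> covered \<tau> u v \<or> covered \<tau> v u"
proof -
  have cov: "covered \<tau> u v" if u: "u \<in> L - D" and v: "v \<in> L" and uv: "{u, v} \<in> E" for u v
  proof (cases "cl (\<sigma> u) = cl (\<sigma> v)")
    case True
    then show ?thesis
      unfolding covered_def by (intro disjI1 cl)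
  next
    case False
    have "{v, u} \<in> E"
      using uv by (simp add: insert_commute)
    then obtain w where "w \<in> picks (\<lambda>v. cl (\<sigma> v)) L u" "cl (\<sigma> w) = cl (\<sigma> v)"
      using picks_cover[of v u L "\<lambda>v. cl (\<sigma> v)"] False v by auto
    then show ?thesis
      using cl[of w v] u by (auto simp: covered_def sel)
  qed
  \<comment> \<open>A vertex that picks was live and had selected nothing, so overwriting
    \<open>sel\<close> loses nothing.\<close>
  have sub: "sel (\<sigma> w) \<subseteq> sel (\<tau> w)" for w
    using inv by (auto simp: phase_inv_def sel L_def)
  consider "u \<in> L" "v \<in> L" | "covered \<sigma> u v" | "covered \<sigma> v u"
    using inv e unfolding phase_inv_def L_def by blast
  then show ?thesis
  proof cases
    case 1
    then show ?thesis
      using cov[of u v] cov[of v u] e by (auto simp: insert_commute)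
  next
    case 2
    then show ?thesis
      by (intro disjI2 disjI1) (rule covered_mono[OF 2], rule sub, erule cl)
  next
    case 3
    then show ?thesis
      by (intro disjI2) (rule covered_mono[OF 3], rule sub, erule cl)
  qed
qed

text \<open>The live clusters after merging are named by centers, whose number
  \<open>card_centers\<close> bounds by the old count divided by \<open>\<theta>\<close>.\<close>

lemma phase_inv_step:
  assumes inv: "phase_inv \<theta> r i \<sigma>" and "\<theta> \<ge> 1" "b > 0" "V \<subseteq> {0<..<b ^ m}"
  shows "phase_inv \<theta> (r + 2 * m * (2 * r + 1)) (Suc i) (exec E (phase_ops b m r \<theta>) \<sigma>)"
proof -
  define c where "c = (\<lambda>v. cl (\<sigma> v))"
  define L where "L = {v. live (\<sigma> v)}"
  define D where "D = dense \<theta> c L"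
  define c' where "c' = merge b m r c D"
  define s where "s = (\<lambda>v. if v \<in> L - D then picks c L v else sel (\<sigma> v))"
  have good: "good r c"
    using inv by (simp add: phase_inv_def c_def)
  have 1: "vid (\<sigma> v) = v" "val (\<sigma> v) = of_bool (live (\<sigma> v))" "live (\<sigma> v) \<Longrightarrow> sel (\<sigma> v) = {}"
    "sel (\<sigma> v) \<subseteq> {w. {w, v} \<in> E}" "real (card (sel (\<sigma> v))) \<le> \<theta> - 1" for v
    using inv by (simp_all add: phase_inv_def)
  obtain z where \<tau>: "exec E (phase_ops b m r \<theta>) \<sigma> = (\<lambda>v. \<sigma> v\<lparr>cl := c' v, val := of_bool (v \<in> D),
      live := v \<in> D, cand := z v, sel := s v\<rparr>)"
    using exec_phase_ops[of \<sigma> r b m \<theta>] 1(2) good unfolding c'_def s_def D_def c_def L_def by blast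
  define \<tau> where "\<tau> = exec E (phase_ops b m r \<theta>) \<sigma>"
  have \<tau>_simps: "vid (\<tau> v) = v" "cl (\<tau> v) = c' v" "val (\<tau> v) = of_bool (v \<in> D)" "live (\<tau> v) \<longleftrightarrow> v \<in> D"
    "sel (\<tau> v) = s v" for v
    by (simp_all add: \<tau>_def \<tau> 1)
  have D: "D \<subseteq> L" "D \<subseteq> V"
    using dense_in_V[OF assms(2)] by (auto simp: D_def dense_def)
  have cD: "c ` D \<subseteq> {0<..<b ^ m}"
    using good_root_in_V[OF good] D(2) assms(4) by blast
  have coarse: "c' x = c' y" if "c x = c y" for x y
    using merge_coarser[OF good that] by (simp add: c'_def)
  have "good (r + 2 * m * (2 * r + 1)) (\<lambda>v. cl (\<tau> v))"
    using good_merge[OF assms(3) cD good] by (simp add: \<tau>_simps c'_def)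
  moreover have "s v \<subseteq> {w. {w, v} \<in> E} \<and> real (card (s v)) \<le> \<theta> - 1 \<and> (v \<in> D \<longrightarrow> s v = {})" for v
    using 1(3-5)[of v] picks_nbrs[of c L v] card_picks[of v L \<theta> c] D(1) by (auto simp: s_def D_def L_def)
  moreover have "live (\<tau> u) \<and> live (\<tau> v) \<or> covered \<tau> u v \<or> covered \<tau> v u" if e: "{u, v} \<in> E" for u v
  proof -
    have sel: "sel (\<tau> v) = (if v \<in> {v. live (\<sigma> v)} - dense \<theta> (\<lambda>v. cl (\<sigma> v)) {v. live (\<sigma> v)}
        then picks (\<lambda>v. cl (\<sigma> v)) {v. live (\<sigma> v)} v else sel (\<sigma> v))" for v
      by (simp add: \<tau>_simps s_def D_def c_def L_def)
    have cl: "cl (\<tau> x) = cl (\<tau> y)" if "cl (\<sigma> x) = cl (\<sigma> y)" for x y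
      unfolding \<tau>_simps by (rule coarse) (simp add: c_def that)
    show ?thesis
      unfolding \<tau>_simps(4) D_def c_def L_def by (rule covered_after_dense[OF inv e sel cl])
  qed
  moreover have "real (card ((\<lambda>v. cl (\<tau> v)) ` ({v. live (\<tau> v)} \<inter> V))) * \<theta> ^ Suc i \<le> real (card V)"
  proof -
    have cD': "c ` D \<subseteq> {..<b ^ m}"
      using cD by auto
    have "centers b m c D \<subseteq> c ` D"
      by (rule centers(1)[OF assms(3) cD'])
    then have "finite (centers b m c D)"
      using finite_subset finite_imageI D(2) finite_V by metis
    moreover have "(\<lambda>v. cl (\<tau> v)) ` ({v. live (\<tau> v)} \<inter> V) \<subseteq> centers b m c D"
      using merge_in_centers[OF assms(3) cD good] by (auto simp: \<tau>_simps c'_def)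
    ultimately have "card ((\<lambda>v. cl (\<tau> v)) ` ({v. live (\<tau> v)} \<inter> V)) \<le> card (centers b m c D)"
      by (rule card_mono)
    then have "real (card ((\<lambda>v. cl (\<tau> v)) ` ({v. live (\<tau> v)} \<inter> V))) * \<theta> \<le> real (card (centers b m c D)) * \<theta>"
      using assms(2) by (intro mult_right_mono) auto
    also have "\<dots> \<le> real (card (c ` (L \<inter> V)))"
      using card_centers[OF assms(3) _ assms(2)] cD' unfolding D_def by blast
    finally have "real (card ((\<lambda>v. cl (\<tau> v)) ` ({v. live (\<tau> v)} \<inter> V))) * \<theta> * \<theta> ^ i \<le>
        real (card (c ` (L \<inter> V))) * \<theta> ^ i"
      using assms(2) by (intro mult_right_mono) auto
    also have "\<dots> \<le> real (card V)"
      using inv by (simp add: phase_inv_def c_def L_def)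
    finally show ?thesis
      by (simp add: mult.assoc)
  qed
  ultimately show ?thesis
    unfolding phase_inv_def \<tau>_def[symmetric] by (simp add: \<tau>_simps)
qed

text \<open>At most \<open>\<theta>\<close> live clusters remain, so no vertex sees more than
  \<open>\<theta>\<close> of them and all die; no edge is left with both ends live.\<close>

lemma phase_inv_final:
  assumes inv: "phase_inv \<theta> r i \<sigma>" and "\<theta> \<ge> 1" "real (card V) \<le> \<theta> ^ Suc i"
  defines "\<tau> \<equiv> step E (dense_op \<theta>) \<sigma>"
  shows "good r (\<lambda>v. cl (\<tau> v))" "vid (\<tau> v) = v" "sel (\<tau> v) \<subseteq> {w. {w, v} \<in> E}"
    "real (card (sel (\<tau> v))) \<le> \<theta> - 1" "{u, w} \<in> E \<Longrightarrow> covered \<tau> u w \<or> covered \<tau> w u"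
proof -
  define c where "c = (\<lambda>v. cl (\<sigma> v))"
  define L where "L = {v. live (\<sigma> v)}"
  define D where "D = dense \<theta> c L"
  have 1: "good r c" "vid (\<sigma> v) = v" "\<forall>v. val (\<sigma> v) = of_bool (live (\<sigma> v))" "live (\<sigma> v) \<Longrightarrow> sel (\<sigma> v) = {}"
    "sel (\<sigma> v) \<subseteq> {w. {w, v} \<in> E}" "real (card (sel (\<sigma> v))) \<le> \<theta> - 1" for v
    using inv by (simp_all add: phase_inv_def c_def)
  have "real (card (c ` (L \<inter> V))) * \<theta> ^ i \<le> \<theta> * \<theta> ^ i"
    using inv assms(3) by (simp add: phase_inv_def c_def L_def)
  then have few: "real (card (c ` (L \<inter> V))) \<le> \<theta>"
    using assms(2) by simp
  have "D = {}"
  proof (rule ccontr)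
    assume "D \<noteq> {}"
    then obtain x where x: "x \<in> D"
      by blast
    then have "insert (c x) (adj_clusters c L x) \<subseteq> c ` (L \<inter> V)"
      using nbr_clusters dense_in_V[OF assms(2), of c L] unfolding D_def dense_def by blast
    then have "card (insert (c x) (adj_clusters c L x)) \<le> card (c ` (L \<inter> V))"
      using finite_V by (intro card_mono) auto
    then show False
      using few x by (simp add: D_def dense_def)
  qed
  have \<tau>: "\<tau> = (\<lambda>v. \<sigma> v\<lparr>val := of_bool (v \<in> D), live := v \<in> D,
      sel := if v \<in> L - D then picks c L v else sel (\<sigma> v)\<rparr>)"
    unfolding \<tau>_def step_dense_op[OF 1(3)] D_def c_def L_def ..
  show "good r (\<lambda>v. cl (\<tau> v))" "vid (\<tau> v) = v"
    using 1 by (simp_all add: \<tau> c_def)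
  show "sel (\<tau> v) \<subseteq> {w. {w, v} \<in> E}" "real (card (sel (\<tau> v))) \<le> \<theta> - 1"
    using 1(5,6)[of v] picks_nbrs[of c L v] card_picks[of v L \<theta> c] by (auto simp: \<tau> D_def)
  show "covered \<tau> u w \<or> covered \<tau> w u" if "{u, w} \<in> E"
  proof -
    have "u \<in> D \<and> w \<in> D \<or> covered \<tau> u w \<or> covered \<tau> w u"
      unfolding D_def c_def L_def
      by (rule covered_after_dense[OF inv that]) (unfold \<tau> D_def c_def L_def, simp_all)
    then show ?thesis
      using \<open>D = {}\<close> by simp
  qed
qed

end


section \<open>Spanning trees of the final clusters\<close>

text \<open>A nonzero \<open>val\<close> marks membership in the tree of the own cluster. A parent
  edge is added only on joining, hence at most once.\<close>

definition grow_op :: op where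
  "grow_op st ib = (if val st = 0 \<and> (\<exists>w y. ib w = Some (cl st, y) \<and> y \<noteq> 0)
     then st\<lparr>val := 1, sel := insert (LEAST w. \<exists>y. ib w = Some (cl st, y) \<and> y \<noteq> 0) (sel st)\<rparr> else st)"

definition tree_ops :: "nat \<Rightarrow> op list" where
  "tree_ops r = (\<lambda>st _. st\<lparr>val := of_bool (cl st = vid st)\<rparr>) # replicate r grow_op"

lemma sym_adj: "sym (adj E)"
  by (auto simp: adj_def sym_def insert_commute)

lemma adj_mono: "A \<subseteq> B \<Longrightarrow> adj A \<subseteq> adj B"
  by (auto simp: adj_def)

context finite_graph
begin

lemma step_grow_op:
  fixes \<tau> :: "nat \<Rightarrow> vstate"
  shows "step E grow_op \<tau> v = \<tau> v \<and>
      (val (\<tau> v) \<noteq> 0 \<or> (\<forall>w. {w, v} \<in> E \<longrightarrow> cl (\<tau> w) = cl (\<tau> v) \<longrightarrow> val (\<tau> w) = 0)) \<or>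
    (\<exists>w. val (\<tau> v) = 0 \<and> {w, v} \<in> E \<and> cl (\<tau> w) = cl (\<tau> v) \<and> val (\<tau> w) \<noteq> 0 \<and>
      step E grow_op \<tau> v = \<tau> v\<lparr>val := 1, sel := insert w (sel (\<tau> v))\<rparr>)"
proof -
  define P where "P = (\<lambda>w. {w, v} \<in> E \<and> cl (\<tau> w) = cl (\<tau> v) \<and> val (\<tau> w) \<noteq> 0)"
  have P: "(\<exists>y. inb E \<tau> v w = Some (cl (\<tau> v), y) \<and> y \<noteq> 0) \<longleftrightarrow> P w" for w
    by (auto simp: P_def inb_def)
  have *: "step E grow_op \<tau> v = (if val (\<tau> v) = 0 \<and> (\<exists>w. P w)
      then \<tau> v\<lparr>val := 1, sel := insert (LEAST w. P w) (sel (\<tau> v))\<rparr> else \<tau> v)"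
    unfolding step_def grow_op_def P ..
  show ?thesis
  proof (cases "val (\<tau> v) = 0 \<and> (\<exists>w. P w)")
    case True
    then have "P (LEAST w. P w)"
      using LeastI_ex by blast
    then show ?thesis
      using True unfolding * P_def by auto
  next
    case False
    then show ?thesis
      unfolding * by (auto simp: P_def)
  qed
qed

text \<open>The conjuncts support one another: an unjoined vertex still has its original selection,
  so joining adds at most one edge; the parent joined earlier and supplies the path to the root; and
  the tree advances one step per round, so \<open>r\<close> rounds exhaust a cluster of radius
  \<open>r\<close>.\<close>

lemma exec_tree_ops:
  fixes \<sigma> :: "nat \<Rightarrow> vstate"
  assumes vid: "\<And>v. vid (\<sigma> v) = v" and sel: "\<And>v. sel (\<sigma> v) \<subseteq> {w. {w, v} \<in> E}"
  defines "c \<equiv> \<lambda>v. cl (\<sigma> v)"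
  defines "\<tau> \<equiv> \<lambda>t. exec E (tree_ops t) \<sigma>"
  shows "cl (\<tau> t v) = c v \<and> (val (\<tau> t v) = 0 \<longrightarrow> sel (\<tau> t v) = sel (\<sigma> v)) \<and>
    sel (\<sigma> v) \<subseteq> sel (\<tau> t v) \<and> sel (\<tau> t v) \<subseteq> {w. {w, v} \<in> E} \<and>
    card (sel (\<tau> t v)) \<le> Suc (card (sel (\<sigma> v))) \<and>
    (val (\<tau> t v) \<noteq> 0 \<longrightarrow> (\<exists>j\<le>t. (c v, v) \<in> adj (selected_edges (\<tau> t)) ^^ j)) \<and>
    (\<forall>j\<le>t. (c v, v) \<in> inner c ^^ j \<longrightarrow> val (\<tau> t v) \<noteq> 0)"
proof (induction t arbitrary: v)
  case 0
  then show ?case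
    using sel by (auto simp: \<tau>_def tree_ops_def exec_Cons step_def vid c_def)
next
  case (Suc t)
  have \<tau>: "\<tau> (Suc t) = step E grow_op (\<tau> t)"
    unfolding \<tau>_def tree_ops_def replicate_Suc replicate_append_same[symmetric]
    by (simp add: exec_Cons exec_append)
  note G = step_grow_op[of "\<tau> t", folded \<tau>]
  have mono: "sel (\<tau> t v) \<subseteq> sel (\<tau> (Suc t) v)" "val (\<tau> t v) \<noteq> 0 \<Longrightarrow> val (\<tau> (Suc t) v) \<noteq> 0" for v
    using G[of v] by auto
  then have "selected_edges (\<tau> t) \<subseteq> selected_edges (\<tau> (Suc t))"
    unfolding selected_edges_def by blast
  then have path: "(x, y) \<in> adj (selected_edges (\<tau> (Suc t))) ^^ j"
    if "(x, y) \<in> adj (selected_edges (\<tau> t)) ^^ j" for x y j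
    using that relpow_subset[OF adj_mono] by blast
  have cl: "cl (\<tau> t v) = c v" for v
    using Suc by blast
  have reach: "val (\<tau> (Suc t) v) \<noteq> 0" if j: "j \<le> Suc t" "(c v, v) \<in> inner c ^^ j" for j
  proof (cases "j \<le> t")
    case True
    then show ?thesis
      using Suc j(2) mono(2) by blast
  next
    case False
    then have "j = Suc t"
      using j(1) by simp
    then obtain w where w: "(c v, w) \<in> inner c ^^ t" "{w, v} \<in> E" "c w = c v"
      using j(2) by (auto simp: inner_def)
    then have "(c w, w) \<in> inner c ^^ t"
      by simp
    then have "val (\<tau> t w) \<noteq> 0"
      using Suc by blast
    then show ?thesis
      using G[of v] w(2,3) cl by (elim disjE) auto
  qed
  consider "\<tau> (Suc t) v = \<tau> t v" | w where "val (\<tau> t v) = 0" "{w, v} \<in> E" "c w = c v" "val (\<tau> t w) \<noteq> 0"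
    "\<tau> (Suc t) v = \<tau> t v\<lparr>val := 1, sel := insert w (sel (\<tau> t v))\<rparr>"
    using G[of v] cl by auto
  then show ?case
  proof cases
    case 1
    have "\<exists>j\<le>Suc t. (c v, v) \<in> adj (selected_edges (\<tau> (Suc t))) ^^ j" if "val (\<tau> t v) \<noteq> 0"
      using Suc[of v] that path le_SucI by meson
    then show ?thesis
      using Suc[of v] 1 reach by auto
  next
    case 2
    have sel_t: "sel (\<tau> t v) = sel (\<sigma> v)"
      using Suc 2 by blast
    have "w \<in> sel (\<tau> (Suc t) v)"
      using 2 by simp
    then have "(w, v) \<in> adj (selected_edges (\<tau> (Suc t)))"
      unfolding adj_def selected_edges_def by (auto simp: insert_commute)
    moreover obtain j where "j \<le> t" "(c w, w) \<in> adj (selected_edges (\<tau> (Suc t))) ^^ j"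
      using Suc[of w] 2(4) path by blast
    ultimately have "\<exists>j\<le>Suc t. (c v, v) \<in> adj (selected_edges (\<tau> (Suc t))) ^^ j"
      using 2(3) by (intro exI[of _ "Suc j"]) auto
    moreover have "card (insert w (sel (\<sigma> v))) \<le> Suc (card (sel (\<sigma> v)))"
      by (simp add: card_insert_if finite_subset[OF sel finite_nbrs])
    ultimately show ?thesis
      using Suc[of v] 2 sel_t reach sel by auto
  qed
qed

text \<open>Final clusters are unions of the clusters of every phase, so an edge that was covered in some
  phase is still covered with respect to the final clusters.\<close>

lemma edge_stretch:
  fixes \<sigma> :: "nat \<Rightarrow> vstate"
  assumes vid: "\<And>v. vid (\<sigma> v) = v" and sel: "\<And>v. sel (\<sigma> v) \<subseteq> {w. {w, v} \<in> E}"
    and good: "good r (\<lambda>v. cl (\<sigma> v))"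
    and cov: "\<And>u v. {u, v} \<in> E \<Longrightarrow> covered \<sigma> u v \<or> covered \<sigma> v u"
  defines "H \<equiv> selected_edges (exec E (tree_ops r) \<sigma>)"
  assumes "(u, v) \<in> adj E"
  shows "\<exists>j\<le>2 * r + 1. (u, v) \<in> adj H ^^ j"
proof -
  let ?c = "\<lambda>v. cl (\<sigma> v)"
  let ?\<tau> = "exec E (tree_ops r) \<sigma>"
  note T = exec_tree_ops[OF vid sel, of r]
  have root: "\<exists>j\<le>r. (?c v, v) \<in> adj H ^^ j" for v
    using T[of v] good unfolding good_def H_def by blast
  have same: "\<exists>j\<le>2 * r. (u, v) \<in> adj H ^^ j" if "?c u = ?c v" for u v
  proof -
    obtain i j where ij: "i \<le> r" "(?c u, u) \<in> adj H ^^ i" "j \<le> r" "(?c v, v) \<in> adj H ^^ j"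
      using root by blast
    have "(u, ?c u) \<in> adj H ^^ i"
      by (rule symD[OF sym_relpow[OF sym_adj] ij(2)])
    then have "(u, v) \<in> adj H ^^ (i + j)"
      using ij(4) that unfolding relpow_add by (intro relcompI[of u "?c u"]) simp_all
    then show ?thesis
      using ij(1,3) by (intro exI[of _ "i + j"]) simp
  qed
  have cov': "\<exists>j\<le>2 * r + 1. (u, v) \<in> adj H ^^ j" if uv: "covered \<sigma> u v" for u v
  proof (cases "?c u = ?c v")
    case True
    then show ?thesis
      using same[of u v] by (meson le_add1 order_trans)
  next
    case False
    then obtain w where w: "w \<in> sel (\<sigma> u)" "?c w = ?c v"
      using uv by (auto simp: covered_def)
    then have "(u, w) \<in> adj H"
      using T[of u] by (auto simp: adj_def H_def selected_edges_def)
    moreover obtain j where "j \<le> 2 * r" "(w, v) \<in> adj H ^^ j"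
      using same[OF w(2)] by blast
    ultimately show ?thesis
      by (intro exI[of _ "Suc j"]) (auto intro: relpow_Suc_I2 simp del: relpow.simps)
  qed
  have "{u, v} \<in> E"
    using assms(6) by (simp add: adj_def)
  then show ?thesis
    using cov[of u v] cov'[of u v] cov'[of v u] sym_relpow[OF sym_adj[of H]] by (blast dest: symD)
qed

end

section \<open>From the stretch of edges to the stretch of distances\<close>

lemma path_stretch:
  fixes R S :: "'a rel"
  assumes "\<And>u v. (u, v) \<in> R \<Longrightarrow> \<exists>j\<le>a. (u, v) \<in> S ^^ j" "(u, v) \<in> R ^^ k"
  shows "\<exists>j\<le>a * k. (u, v) \<in> S ^^ j"
  using assms(2)
proof (induction k arbitrary: v)
  case (Suc k)
  then obtain w where w: "(u, w) \<in> R ^^ k" "(w, v) \<in> R"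
    by auto
  obtain i j where "i \<le> a * k" "(u, w) \<in> S ^^ i" "j \<le> a" "(w, v) \<in> S ^^ j"
    using Suc.IH[OF w(1)] assms(1)[OF w(2)] by blast
  then show ?case
    by (intro exI[of _ "i + j"]) (auto simp: relpow_add)
qed auto

lemma hop_dist_le: "(u, v) \<in> adj E ^^ k \<Longrightarrow> hop_dist E u v \<le> enat k"
  unfolding hop_dist_def by (rule INF_lower) simp

lemma hop_dist_attained:
  assumes "hop_dist E u v = enat k"
  shows "(u, v) \<in> adj E ^^ k"
proof -
  let ?A = "enat ` {k. (u, v) \<in> adj E ^^ k}"
  have "?A \<noteq> {}"
  proof
    assume "?A = {}"
    then have "hop_dist E u v = \<infinity>"
      by (simp only: hop_dist_def Inf_enat_def simp_thms if_True)
    then show False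
      using assms by simp
  qed
  then obtain x where "x \<in> ?A"
    by blast
  then have "Inf ?A \<in> ?A"
    unfolding Inf_enat_def using LeastI[of "\<lambda>x. x \<in> ?A" x] by auto
  then show ?thesis
    using assms by (auto simp: hop_dist_def)
qed

lemma spannerI:
  assumes "H \<subseteq> E" "\<And>u v. (u, v) \<in> adj E \<Longrightarrow> \<exists>j\<le>a. (u, v) \<in> adj H ^^ j" "real a \<le> \<alpha>" "\<alpha> > 0"
  shows "spanner \<alpha> V E H"
  unfolding spanner_def
proof (intro conjI ballI)
  fix u v
  show "ereal_of_enat (hop_dist H u v) \<le> ereal \<alpha> * ereal_of_enat (hop_dist E u v)"
  proof (cases "hop_dist E u v")
    case (enat k)
    obtain j where j: "j \<le> a * k" "(u, v) \<in> adj H ^^ j"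
      using path_stretch[OF assms(2) hop_dist_attained[OF enat]] by blast
    have "ereal_of_enat (hop_dist H u v) \<le> ereal_of_enat (enat j)"
      using hop_dist_le[OF j(2)] by (simp only: ereal_of_enat_le_iff)
    also have "\<dots> \<le> ereal (\<alpha> * real k)"
    proof -
      have "real j \<le> real a * real k"
        using j(1) by (metis of_nat_le_iff of_nat_mult)
      also have "\<dots> \<le> \<alpha> * real k"
        using assms(3) by (simp add: mult_right_mono)
      finally show ?thesis
        by simp
    qed
    finally show ?thesis
      by (simp add: enat)
  \<comment> \<open>For infinite distance in \<open>E\<close> the right-hand side is infinite
    because \<open>\<alpha>\<close> is positive.\<close>
  qed (use assms(4) in simp)
qed (rule assms(1))


section \<open>The spanner algorithm\<close>

primrec radius :: "nat \<Rightarrow> nat \<Rightarrow> nat" where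
  "radius m 0 = 0"
| "radius m (Suc i) = radius m i + 2 * m * (2 * radius m i + 1)"

lemma radius: "2 * radius m i + 1 = (4 * m + 1) ^ i"
  by (induction i) (auto simp: algebra_simps)

definition phases :: "nat \<Rightarrow> nat \<Rightarrow> real \<Rightarrow> nat \<Rightarrow> op list" where
  "phases b m \<theta> k = concat (map (\<lambda>i. phase_ops b m (radius m i) \<theta>) [0..<k])"

definition spanner_ops :: "nat \<Rightarrow> nat \<Rightarrow> real \<Rightarrow> nat \<Rightarrow> op list" where
  "spanner_ops b m \<theta> k = phases b m \<theta> k @ dense_op \<theta> # tree_ops (radius m k)"

lemma (in finite_graph) phase_inv_phases:
  assumes "\<theta> \<ge> 1" "b > 0" "V \<subseteq> {0<..<b ^ m}"
  shows "phase_inv \<theta> (radius m k) k (exec E (phases b m \<theta> k) init)"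
  using phase_inv_init[OF assms(1)] phase_inv_step[OF _ assms]
  by (induction k) (simp_all add: phases_def exec_append)

text \<open>Per vertex, at most \<open>\<theta> - 1\<close> edges selected in the phases and at most
  one parent edge make at most \<open>\<theta>\<close>. The stretch is \<open>2 * r + 1\<close> for
  the final radius \<open>r\<close>.\<close>

lemma (in finite_graph) spanner_ops:
  assumes "\<theta> \<ge> 1" "b > 0" "V \<subseteq> {0<..<b ^ m}" "real (card V) \<le> \<theta> ^ Suc k"
  defines "\<tau> \<equiv> exec E (spanner_ops b m \<theta> k) init"
  shows "sel (\<tau> v) \<subseteq> {w. {w, v} \<in> E}"
    and "(u, v) \<in> adj E \<Longrightarrow> \<exists>j\<le>(4 * m + 1) ^ k. (u, v) \<in> adj (selected_edges \<tau>) ^^ j"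
    and "real (card (selected_edges \<tau>)) \<le> real (card V) * \<theta>"
proof -
  define \<sigma> where "\<sigma> = step E (dense_op \<theta>) (exec E (phases b m \<theta> k) init)"
  note F = phase_inv_final[OF phase_inv_phases[OF assms(1-3)] assms(1,4), folded \<sigma>_def]
  have \<tau>: "\<tau> = exec E (tree_ops (radius m k)) \<sigma>"
    by (simp add: \<tau>_def \<sigma>_def spanner_ops_def exec_append exec_Cons)
  note T = exec_tree_ops[OF F(2,3), of "radius m k", folded \<tau>]
  show sel: "sel (\<tau> v) \<subseteq> {w. {w, v} \<in> E}" for v
    using T by blast
  show "\<exists>j\<le>(4 * m + 1) ^ k. (u, v) \<in> adj (selected_edges \<tau>) ^^ j" if "(u, v) \<in> adj E"
    using edge_stretch[OF F(2,3,1,5) that] by (simp only: \<tau> radius)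
  have "selected_edges \<tau> \<subseteq> (\<Union>v\<in>V. (\<lambda>w. {v, w}) ` sel (\<tau> v))"
    using sel edge_in_V(2) by (fastforce simp: selected_edges_def)
  moreover have fin: "finite (sel (\<tau> v))" for v
    using finite_subset[OF sel finite_nbrs] .
  ultimately have "card (selected_edges \<tau>) \<le> card (\<Union>v\<in>V. (\<lambda>w. {v, w}) ` sel (\<tau> v))"
    using finite_V by (intro card_mono) auto
  also have "\<dots> \<le> (\<Sum>v\<in>V. card ((\<lambda>w. {v, w}) ` sel (\<tau> v)))"
    by (rule card_UN_le[OF finite_V])
  also have "\<dots> \<le> (\<Sum>v\<in>V. Suc (card (sel (\<sigma> v))))"
    using T fin by (intro sum_mono) (meson card_image_le order_trans)
  finally have "real (card (selected_edges \<tau>)) \<le> (\<Sum>v\<in>V. real (Suc (card (sel (\<sigma> v)))))"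
    by (metis of_nat_le_iff of_nat_sum)
  also have "\<dots> \<le> (\<Sum>v\<in>V. \<theta>)"
    using F(4) by (intro sum_mono) (simp add: algebra_simps)
  finally show "real (card (selected_edges \<tau>)) \<le> real (card V) * \<theta>"
    by simp
qed

section \<open>All values sent stay in the ID range\<close>

lemma Max_insert_le: "a \<le> N \<Longrightarrow> (\<And>y. y \<in> A \<Longrightarrow> y \<le> N) \<Longrightarrow> Max (insert a A) \<le> (N :: nat)"
  \<comment> \<open>The bound also makes \<open>A\<close> finite, as \<open>Max\<close>
    requires.\<close>
  by (subst Max_le_iff) (auto intro: finite_subset[of A "{..N}"])

lemma valid_op_in_op: "valid_op N in_op"
  by (auto simp: valid_op_def valid_pair_def in_op_def ran_def intro!: Max_insert_le)

lemma valid_op_out_op: "valid_op N out_op"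
  by (fastforce simp: valid_op_def valid_pair_def out_op_def ran_def intro!: Max_insert_le)

lemma valid_hood_ops: "f \<in> set (hood_ops r) \<Longrightarrow> valid_op N f"
  by (auto simp: hood_ops_def valid_op_in_op valid_op_out_op)

lemma valid_prune_ops: "f \<in> set (prune_ops b r t j) \<Longrightarrow> valid_op N f"
  by (auto simp: prune_ops_def valid_hood_ops) (auto simp: valid_op_def valid_pair_def)

lemma valid_phase_ops: "f \<in> set (phase_ops b m r \<theta>) \<Longrightarrow> valid_op N f"
  by (auto simp: phase_ops_def ruling_ops_def valid_hood_ops valid_prune_ops valid_op_in_op)
    (auto simp: valid_op_def valid_pair_def dense_op_def Let_def)

lemma valid_tree_ops: "f \<in> set (tree_ops r) \<Longrightarrow> valid_op N f"
  by (auto simp: tree_ops_def valid_op_def valid_pair_def grow_op_def)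

lemma valid_spanner_ops: "f \<in> set (spanner_ops b m \<theta> k) \<Longrightarrow> valid_op N f"
  by (auto simp: spanner_ops_def phases_def valid_phase_ops valid_tree_ops)
    (auto simp: valid_op_def valid_pair_def dense_op_def Let_def)

section \<open>Counting the rounds\<close>

lemma length_phase_ops:
  assumes "m > 0"
  shows "length (phase_ops b m r \<theta>) \<le> (6 + 4 * b) * (m * (2 * r + 1))"
proof -
  \<comment> \<open>Four single operations and the survival flood give \<open>2 * r + 4\<close>;
    each of the \<open>m * b\<close> eliminations has two floods of \<open>2 * r + 1\<close> rounds
    and two single operations.\<close>
  have "length (phase_ops b m r \<theta>) = 2 * r + 4 + m * (b * (2 * (2 * r + 1) + 2)) + 2 * m * (2 * r + 1)"
    by (simp add: phase_ops_def ruling_ops_def prune_ops_def hood_ops_def length_concat sum_list_replicate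
        comp_def sum_list_triv)
  also have "2 * r + 4 \<le> 4 * (m * (2 * r + 1))"
    using assms by (cases m) (auto simp: algebra_simps)
  also have "m * (b * (2 * (2 * r + 1) + 2)) \<le> m * (b * (4 * (2 * r + 1)))"
    by (intro mult_le_mono order_refl) simp
  finally show ?thesis
    by (simp add: algebra_simps)
qed

text \<open>The bounds on the phases form a geometric series with ratio \<open>4 * m + 1\<close>;
  the factor 4 and the subtracted 1 make the sum telescope.\<close>

lemma length_phases:
  assumes "m > 0"
  shows "4 * length (phases b m \<theta> k) \<le> (6 + 4 * b) * ((4 * m + 1) ^ k - 1)"
proof (induction k)
  case (Suc k)
  have "4 * length (phase_ops b m (radius m k) \<theta>) \<le> (6 + 4 * b) * (4 * m * (4 * m + 1) ^ k)"
    using length_phase_ops[OF assms, of b "radius m k" \<theta>] unfolding radius by simp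
  with Suc have "4 * length (phases b m \<theta> (Suc k)) \<le>
      (6 + 4 * b) * ((4 * m + 1) ^ k - 1) + (6 + 4 * b) * (4 * m * (4 * m + 1) ^ k)"
    by (simp add: phases_def)
  also have "\<dots> = (6 + 4 * b) * ((4 * m + 1) ^ k - 1 + 4 * m * (4 * m + 1) ^ k)"
    by (simp only: distrib_left)
  also have "(4 * m + 1) ^ k - 1 + 4 * m * (4 * m + 1) ^ k = (4 * m + 1) ^ Suc k - 1"
    by (simp add: algebra_simps)
  finally show ?case .
qed (simp add: phases_def)

lemma length_spanner_ops:
  assumes "m > 0"
  shows "Suc (length (spanner_ops b m \<theta> k)) \<le> (10 + 4 * b) * (4 * m + 1) ^ k"
proof -
  let ?q = "(4 * m + 1) ^ k"
  have "length (phases b m \<theta> k) \<le> (6 + 4 * b) * (?q - 1)"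
    using length_phases[OF assms, of b \<theta> k] by linarith
  also have "\<dots> \<le> (6 + 4 * b) * ?q"
    by (intro mult_le_mono) auto
  finally have "length (phases b m \<theta> k) \<le> (6 + 4 * b) * ?q" .
  \<comment> \<open>Besides the phases there are one \<open>dense_op\<close>,
    \<open>radius m k + 1\<close> tree operations and the announcing round.\<close>
  moreover have "radius m k + 3 \<le> 4 * ?q"
    using radius[of m k] by linarith
  ultimately show ?thesis
    by (simp add: spanner_ops_def tree_ops_def algebra_simps)
qed

section \<open>Choice of the parameters and the final bounds\<close>

definition spanner_algorithm :: "nat \<Rightarrow> algorithm" where
  "spanner_algorithm C = algorithm_of C (\<lambda>n \<kappa>.
     spanner_ops (4 * C) (nat \<lfloor>log 2 (real n)\<rfloor>) (real n powr (1 / real \<kappa>)) (\<kappa> - 1))"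

lemma floor_log_bounds:
  assumes "n \<ge> 2"
  defines "m \<equiv> nat \<lfloor>log 2 (real n)\<rfloor>"
  shows "m \<ge> 1" "real m \<le> log 2 (real n)" "n < 2 ^ (m + 1)"
proof -
  have l: "log 2 (real n) \<ge> 1"
    using assms by (simp add: le_log_iff)
  then show "m \<ge> 1" "real m \<le> log 2 (real n)"
    by (auto simp: m_def le_nat_iff le_floor_iff)
  have "log 2 (real n) < real (m + 1)"
    using l by (simp add: m_def) linarith
  then have "real n < 2 powr real (m + 1)"
    using assms by (simp add: log_less_iff)
  also have "\<dots> = real (2 ^ (m + 1))"
    by (subst powr_realpow) auto
  finally show "n < 2 ^ (m + 1)"
    using of_nat_less_iff by blast
qed

theorem corollary2p10:
  shows "\<forall>C::nat. C \<ge> 1 \<longrightarrow>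
    (\<exists>(c1::real) (c2::real) (B::nat) (A::algorithm).
       c1 > 0 \<and> c2 > 0 \<and> congest_algorithm C B A \<and>
       (\<forall>(\<kappa>::nat) (n::nat) (V::nat set) (E::nat set set).
          \<kappa> \<ge> 2 \<and> n \<ge> 2 \<and> simple_graph V E \<and> card V = n \<and> connected_graph V E \<and> V \<subseteq> {1..C * n}
          \<longrightarrow> (\<exists>(T::nat) (H::nat set set).
                 constructs A n \<kappa> V E T H \<and>
                 real T \<le> c1 * (c2 * log 2 (real n)) ^ (\<kappa> - 1) \<and>
                 spanner ((4 * log 2 (real n) + 1) ^ (\<kappa> - 1) + 1) V E H \<and>
                 real (card H) \<le> real n powr (1 + 1 / real \<kappa>))))"
proof (intro allI impI)
  fix C :: nat assume C: "C \<ge> 1"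
  have main: "\<exists>T H. constructs (spanner_algorithm C) n \<kappa> V E T H \<and>
      real T \<le> real (10 + 16 * C) * (5 * log 2 (real n)) ^ (\<kappa> - 1) \<and>
      spanner ((4 * log 2 (real n) + 1) ^ (\<kappa> - 1) + 1) V E H \<and>
      real (card H) \<le> real n powr (1 + 1 / real \<kappa>)"
    if \<kappa>: "\<kappa> \<ge> 2" and n: "n \<ge> 2" and G: "simple_graph V E" "card V = n" "V \<subseteq> {1..C * n}"
    for \<kappa> n :: nat and V :: "nat set" and E :: "nat set set"
  proof -
    interpret finite_graph V E
      by unfold_locales (rule G(1))
    define m where "m = nat \<lfloor>log 2 (real n)\<rfloor>"
    define \<theta> where "\<theta> = real n powr (1 / real \<kappa>)"
    define k where "k = \<kappa> - 1"
    define P where "P = spanner_ops (4 * C) m \<theta> k"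
    define \<tau> where "\<tau> = exec E P init"
    let ?l = "log 2 (real n)"
    note m = floor_log_bounds[OF n, folded m_def]
    have \<theta>: "\<theta> \<ge> 1"
      using n by (simp add: \<theta>_def ge_one_powr_ge_zero)
    have "\<theta> ^ Suc k = real n"
      using n \<kappa> by (simp add: \<theta>_def k_def powr_realpow[symmetric] powr_powr del: power_Suc)
    then have card: "real (card V) \<le> \<theta> ^ Suc k"
      by (simp add: G(2))
    \<comment> \<open>As \<open>m\<close> is at least 1, \<open>C\<close> is at most
      \<open>C ^ m\<close> and \<open>2 ^ (m + 1)\<close> at most \<open>4 ^ m\<close>: so
      \<open>m\<close> digits in base \<open>4 * C\<close> cover all IDs.\<close>
    have "C * n < C * 2 ^ (m + 1)"
      using C m(3) by simp
    also have "\<dots> \<le> C ^ m * (2 ^ m * 2 ^ m)"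
    proof (intro mult_le_mono)
      show "C \<le> C ^ m"
        using C m(1) self_le_power[of C m] by simp
      have "(2::nat) ^ 1 \<le> 2 ^ m"
        using m(1) by (intro power_increasing) auto
      then show "(2::nat) ^ (m + 1) \<le> 2 ^ m * 2 ^ m"
        by simp
    qed
    also have "\<dots> = (C * (2 * 2)) ^ m"
      by (simp only: power_mult_distrib)
    also have "\<dots> = (4 * C) ^ m"
      by (simp add: mult.commute)
    finally have V: "V \<subseteq> {0<..<(4 * C) ^ m}"
      using G(3) by fastforce
    have b: "4 * C > 0"
      using C by simp
    note S = spanner_ops[OF \<theta> b V card, folded P_def, folded \<tau>_def]
    have "constructs (spanner_algorithm C) n \<kappa> V E (Suc (length P)) (selected_edges \<tau>)"
    proof -
      let ?prog = "\<lambda>n \<kappa>. spanner_ops (4 * C) (nat \<lfloor>log 2 (real n)\<rfloor>) (real n powr (1 / real \<kappa>)) (\<kappa> - 1)"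
      have P: "?prog n \<kappa> = P"
        by (simp add: P_def m_def \<theta>_def k_def)
      have "\<forall>f\<in>set (?prog n \<kappa>). valid_op (C * n) f"
        using valid_spanner_ops by blast
      note A = algorithm_of_constructs[where prog = ?prog, OF G(1,3) this,
          unfolded P, folded spanner_algorithm_def \<tau>_def]
      show ?thesis
      proof (rule A)
        show "\<forall>w\<in>sel (\<tau> v). {v, w} \<in> E" for v
        proof
          fix w assume "w \<in> sel (\<tau> v)"
          then have "{w, v} \<in> E"
            using S(1) by blast
          then show "{v, w} \<in> E"
            by (simp add: insert_commute)
        qed
        show "sel (\<tau> v) = {}" if "v \<notin> V" for v
          using S(1) edge_in_V(2) that by blast
      qed
    qed
    moreover have "real (Suc (length P)) \<le> real (10 + 16 * C) * (5 * ?l) ^ k"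
    proof -
      \<comment> \<open>The constant is \<open>10 + 4 * b\<close> for the base
        \<open>b = 4 * C\<close>.\<close>
      have "Suc (length P) \<le> (10 + 16 * C) * (4 * m + 1) ^ k"
        using length_spanner_ops[of m "4 * C" \<theta> k] m(1) by (simp add: P_def)
      then have "real (Suc (length P)) \<le> real ((10 + 16 * C) * (4 * m + 1) ^ k)"
        by (simp only: of_nat_le_iff)
      also have "\<dots> = real (10 + 16 * C) * real (4 * m + 1) ^ k"
        by (simp only: of_nat_mult of_nat_power)
      \<comment> \<open>From \<open>1 \<le> m\<close> and \<open>m \<le> ?l\<close> follows
        \<open>4 * m + 1 \<le> 5 * ?l\<close>, whence the witness 5 for \<open>c2\<close>.\<close>
      also have "\<dots> \<le> real (10 + 16 * C) * (5 * ?l) ^ k"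
        using m(1,2) by (intro mult_left_mono power_mono) auto
      finally show ?thesis .
    qed
    moreover have "spanner ((4 * ?l + 1) ^ k + 1) V E (selected_edges \<tau>)"
    proof (rule spannerI)
      show "selected_edges \<tau> \<subseteq> E"
        using S(1) by (fastforce simp: selected_edges_def insert_commute)
      have "real ((4 * m + 1) ^ k) = real (4 * m + 1) ^ k"
        by simp
      also have "\<dots> \<le> (4 * ?l + 1) ^ k"
        using m(2) by (intro power_mono) auto
      finally show "real ((4 * m + 1) ^ k) \<le> (4 * ?l + 1) ^ k + 1"
        by simp
      then show "(4 * ?l + 1) ^ k + 1 > 0"
        using m by (intro add_nonneg_pos zero_le_power) auto
    qed (rule S(2))
    moreover have "real (card (selected_edges \<tau>)) \<le> real n powr (1 + 1 / real \<kappa>)"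
      using S(3) n by (simp add: G(2) \<theta>_def powr_add)
    ultimately show ?thesis
      unfolding k_def by blast
  qed
  show "\<exists>(c1::real) (c2::real) (B::nat) (A::algorithm).
       c1 > 0 \<and> c2 > 0 \<and> congest_algorithm C B A \<and>
       (\<forall>(\<kappa>::nat) (n::nat) (V::nat set) (E::nat set set).
          \<kappa> \<ge> 2 \<and> n \<ge> 2 \<and> simple_graph V E \<and> card V = n \<and> connected_graph V E \<and> V \<subseteq> {1..C * n}
          \<longrightarrow> (\<exists>(T::nat) (H::nat set set).
                 constructs A n \<kappa> V E T H \<and>
                 real T \<le> c1 * (c2 * log 2 (real n)) ^ (\<kappa> - 1) \<and>
                 spanner ((4 * log 2 (real n) + 1) ^ (\<kappa> - 1) + 1) V E H \<and>
                 real (card H) \<le> real n powr (1 + 1 / real \<kappa>)))"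
    using main congest_algorithm_of[of C]
    by (intro exI[of _ "real (10 + 16 * C)"] exI[of _ 5] exI[of _ 2] exI[of _ "spanner_algorithm C"])
      (auto simp: spanner_algorithm_def simp del: of_nat_add of_nat_mult)
qed

end
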